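(* Let $\mathfrak b$ be the Boolean $C^*$-algebra on $\ell^2(\{\#\}\cup\mathbb Z)$, $\alpha$ the shift on $\mathfrak b$, and let $E:\mathfrak b\to\mathfrak b^{\mathbb Z}$ be given by $$E(A+bI)=\langle Ae_\#,e_\#\rangle P_\#+bI,\qquad A\in\mathcal K(\ell^2(\{\#\}\cup\mathbb Z)),\ b\in\mathbb C.$$ Then the $C^*$-dynamical system $(\mathfrak b,\alpha)$ is uniquely mixing with respect to the fixed point subalgebra, with $E$ the unique invariant conditional expectation onto the fixed point subalgebra $\mathfrak b^{\mathbb Z}$; that is, $\lim_{n\to+\infty}f(\alpha^n(X))=f(E(X))$ for all $X\in\mathfrak b$, $f\in\mathfrak b^*$.
   Context: The Boolean Fock space over $\ell^2(\mathbb Z)$ is $\mathbb C\oplus\ell^2(\mathbb Z)=\ell^2(\{\#\}\cup\mathbb Z)$, with canonical basis $\{e_j\mid j\in\{\#\}\cup\mathbb Z\}$ and vacuum $\Omega=e_\#$. For $i\in\mathbb Z$, $a_i^\dagger(c\oplus g)=0\oplus c\,e_i$ and $a_i(c\oplus g)=\langle g,e_i\rangle\oplus0$. The Boolean $C^*$-algebra $\mathfrak b$ is the unital $C^*$-algebra generated by $\{a_i\mid i\in\mathbb Z\}$; it equals $\mathcal K(\ell^2(\{\#\}\cup\mathbb Z))+\mathbb CI$, with $\mathcal K$ the compact operators. $P_\#=a_ia_i^\dagger$ is the orthogonal projection onto $\mathbb Ce_\#$. The shift is the automorphism $\alpha$ of $\mathfrak b$ with $\alpha(a_i)=a_{i+1}$,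 implemented by the unitary fixing $e_\#$ and sending $e_i$ to $e_{i+1}$. $\mathfrak b^{\mathbb Z}=\{A\in\mathfrak b\mid\alpha(A)=A\}=\mathbb CP_\#\oplus\mathbb C(I-P_\#)$. A conditional expectation $F$ onto $\mathfrak b^{\mathbb Z}$ is invariant if $F\circ\alpha=F$. *)

theory Defs
  imports "HOL-Analysis.Analysis"
begin

section \<open>The Hilbert space of square-summable families\<close>

typedef 'a ell2 = "{x :: 'a \<Rightarrow> complex. (\<lambda>i. (cmod (x i))\<^sup>2) summable_on UNIV}"
  morphisms coord Abs_ell2
  by (rule exI [of _ "\<lambda>_. 0"]) simp

setup_lifting type_definition_ell2

lemma ell2_summable: "(\<lambda>i. (cmod (coord x i))\<^sup>2) summable_on UNIV"
  using coord [of x] by simp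

lemma sq_summableI:
  assumes "\<And>F. finite F \<Longrightarrow> L2_set (\<lambda>i. cmod (x i)) F \<le> C"
  shows "(\<lambda>i. (cmod (x i))\<^sup>2) summable_on UNIV"
    and "sqrt (\<Sum>\<^sub>\<infinity>i. (cmod (x i))\<^sup>2) \<le> C"
proof -
  have C: "0 \<le> C" using assms [of "{}"] by simp
  have b: "(\<Sum>i\<in>F. (cmod (x i))\<^sup>2) \<le> C\<^sup>2" if "finite F" for F
    using assms [OF that] C unfolding L2_set_def
    by (metis real_sqrt_le_iff real_sqrt_unique)
  show s: "(\<lambda>i. (cmod (x i))\<^sup>2) summable_on UNIV"
    by (rule nonneg_bdd_above_summable_on) (auto intro!: bdd_aboveI2 [where M = "C\<^sup>2"] b)
  have "(\<Sum>\<^sub>\<infinity>i. (cmod (x i))\<^sup>2) \<le> C\<^sup>2"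
    by (rule infsum_le_finite_sums [OF s]) (use b in auto)
  then show "sqrt (\<Sum>\<^sub>\<infinity>i. (cmod (x i))\<^sup>2) \<le> C"
    using C real_le_lsqrt by (simp add: infsum_nonneg)
qed

lemma L2_set_le_infsum:
  assumes "(\<lambda>i. (cmod (x i))\<^sup>2) summable_on UNIV" "finite F"
  shows "L2_set (\<lambda>i. cmod (x i)) F \<le> sqrt (\<Sum>\<^sub>\<infinity>i. (cmod (x i))\<^sup>2)"
  unfolding L2_set_def
  by (intro real_sqrt_le_mono finite_sum_le_infsum) (use assms in auto)

lemma L2_set_cmod_add:
  "L2_set (\<lambda>i. cmod (x i + y i)) F \<le> L2_set (\<lambda>i. cmod (x i)) F + L2_set (\<lambda>i. cmod (y i)) F"
  by (rule order_trans [OF _ L2_set_triangle_ineq])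
    (auto intro!: L2_set_mono norm_triangle_ineq)

lemma L2_set_cmod_add_le:
  assumes "(\<lambda>i. (cmod (x i))\<^sup>2) summable_on UNIV" "(\<lambda>i. (cmod (y i))\<^sup>2) summable_on UNIV"
    and "finite F"
  shows "L2_set (\<lambda>i. cmod (x i + y i)) F
    \<le> sqrt (\<Sum>\<^sub>\<infinity>i. (cmod (x i))\<^sup>2) + sqrt (\<Sum>\<^sub>\<infinity>i. (cmod (y i))\<^sup>2)"
  by (rule order_trans [OF L2_set_cmod_add])
    (intro add_mono L2_set_le_infsum assms)

lemma cmod_scale_sq_summable:
  assumes "(\<lambda>i. (cmod (x i))\<^sup>2) summable_on UNIV"
  shows "(\<lambda>i. (cmod (c * x i))\<^sup>2) summable_on UNIV"
  using summable_on_cmult_right [OF assms, of "(cmod c)\<^sup>2"]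
  by (simp add: norm_mult power_mult_distrib)

lift_definition scaleC :: "complex \<Rightarrow> 'a ell2 \<Rightarrow> 'a ell2"  (infixr "*\<^sub>C" 75)
  is "\<lambda>c x i. c * x i"
  by (rule cmod_scale_sq_summable)

instantiation ell2 :: (type) real_vector
begin

lift_definition zero_ell2 :: "'a ell2" is "\<lambda>_. 0" by simp
lift_definition plus_ell2 :: "'a ell2 \<Rightarrow> 'a ell2 \<Rightarrow> 'a ell2" is "\<lambda>x y i. x i + y i"
  by (rule sq_summableI(1)) (rule L2_set_cmod_add_le)
lift_definition uminus_ell2 :: "'a ell2 \<Rightarrow> 'a ell2" is "\<lambda>x i. - x i" by simp
definition minus_ell2 :: "'a ell2 \<Rightarrow> 'a ell2 \<Rightarrow> 'a ell2" where "x - y = x + (- y)" for x y :: "'a ell2"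
definition scaleR_ell2 :: "real \<Rightarrow> 'a ell2 \<Rightarrow> 'a ell2" where "r *\<^sub>R x = complex_of_real r *\<^sub>C x"

instance
  by standard (unfold minus_ell2_def scaleR_ell2_def,
      (transfer, auto simp: algebra_simps fun_eq_iff)+)

end

instantiation ell2 :: (type) real_normed_vector
begin

lift_definition norm_ell2 :: "'a ell2 \<Rightarrow> real" is "\<lambda>x. sqrt (\<Sum>\<^sub>\<infinity>i. (cmod (x i))\<^sup>2)" .
definition sgn_ell2 :: "'a ell2 \<Rightarrow> 'a ell2" where "sgn x = inverse (norm x) *\<^sub>R x" for x :: "'a ell2"
definition dist_ell2 :: "'a ell2 \<Rightarrow> 'a ell2 \<Rightarrow> real" where "dist x y = norm (x - y)" for x y :: "'a ell2"
definition uniformity_ell2 :: "('a ell2 \<times> 'a ell2) filter"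
  where "uniformity_ell2 = (INF e\<in>{0<..}. principal {(x, y). dist x y < e})"
definition open_ell2 :: "'a ell2 set \<Rightarrow> bool"
  where "open_ell2 U = (\<forall>x\<in>U. \<forall>\<^sub>F (x', y) in uniformity. x' = x \<longrightarrow> y \<in> U)"

instance
proof
  fix x y :: "'a ell2" and a :: real
  show "norm x = 0 \<longleftrightarrow> x = 0"
  proof
    assume "norm x = 0"
    then show "x = 0"
    proof transfer
      fix x :: "'a \<Rightarrow> complex"
      assume s: "(\<lambda>i. (cmod (x i))\<^sup>2) summable_on UNIV"
        and z: "sqrt (\<Sum>\<^sub>\<infinity>i. (cmod (x i))\<^sup>2) = 0"
      have "L2_set (\<lambda>i. cmod (x i)) {i} \<le> 0" for i
        using L2_set_le_infsum [OF s, of "{i}"] z by simp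
      then show "x = (\<lambda>_. 0)" by (simp add: fun_eq_iff)
    qed
  qed (transfer, simp)
  show "norm (x + y) \<le> norm x + norm y"
    by transfer (rule sq_summableI(2), rule L2_set_cmod_add_le)
  show "norm (a *\<^sub>R x) = \<bar>a\<bar> * norm x"
    unfolding scaleR_ell2_def
    by transfer (simp add: norm_mult power_mult_distrib infsum_cmult_right' real_sqrt_mult)
qed (simp_all add: sgn_ell2_def dist_ell2_def uniformity_ell2_def open_ell2_def)

end

lift_definition cinner :: "'a ell2 \<Rightarrow> 'a ell2 \<Rightarrow> complex"
  is "\<lambda>x y. \<Sum>\<^sub>\<infinity>i. x i * cnj (y i)" .

lift_definition basis :: "'a \<Rightarrow> 'a ell2" is "\<lambda>k i. if i = k then 1 else 0"
proof -
  fix k :: 'a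
  have "((\<lambda>i. (cmod (if i = k then 1 else 0))\<^sup>2) summable_on {k})" by simp
  then show "(\<lambda>i. (cmod (if i = k then 1 else 0))\<^sup>2) summable_on UNIV"
    by (rule summable_on_cong_neutral [THEN iffD1, rotated -1]) auto
qed

lemma coord_simps [simp]:
  "coord (x + y) i = coord x i + coord y i"
  "coord (c *\<^sub>C x) i = c * coord x i"
  "coord 0 i = 0"
  "coord (basis k) i = (if i = k then 1 else 0)"
  by (transfer, simp)+

lemma coord_diff [simp]: "coord (x - y) i = coord x i - coord y i"
  unfolding minus_ell2_def by transfer simp

lemma coord_scaleR [simp]: "coord (r *\<^sub>R x) i = complex_of_real r * coord x i"
  unfolding scaleR_ell2_def by simp

lemma ell2_eqI: "(\<And>i. coord x i = coord y i) \<Longrightarrow> x = y"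
  by (simp add: coord_inject [symmetric] fun_eq_iff)

lemma L2_set_le_norm: "finite F \<Longrightarrow> L2_set (\<lambda>i. cmod (coord x i)) F \<le> norm x"
  by transfer (rule L2_set_le_infsum)

lemma cmod_coord_le_norm: "cmod (coord x i) \<le> norm x"
  using L2_set_le_norm [of "{i}" x] by simp

lemma norm_scaleC [simp]: "norm (c *\<^sub>C x) = cmod c * norm x"
  by transfer (simp add: norm_mult power_mult_distrib infsum_cmult_right' real_sqrt_mult)

lemma cinner_basis_right [simp]: "cinner x (basis k) = coord x k"
proof transfer
  fix x :: "'a \<Rightarrow> complex" and k
  have "(\<Sum>\<^sub>\<infinity>i. x i * cnj (if i = k then 1 else 0)) = (\<Sum>\<^sub>\<infinity>i\<in>{k}. x i * cnj (if i = k then 1 else 0))"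
    by (rule infsum_cong_neutral) auto
  then show "(\<Sum>\<^sub>\<infinity>i. x i * cnj (if i = k then 1 else 0)) = x k" by simp
qed

section \<open>Bounded operators\<close>

text \<open>Elements of \<^typ>\<open>'a ell2 \<Rightarrow>\<^sub>L 'a ell2\<close> are only real-linear; the bounded operators
  of the complex Hilbert space are those in \<open>bounded_ops\<close>.\<close>

type_synonym 'a op = "'a ell2 \<Rightarrow>\<^sub>L 'a ell2"

definition bounded_ops :: "'a op set"
  where "bounded_ops = {T. \<forall>c x. blinfun_apply T (c *\<^sub>C x) = c *\<^sub>C blinfun_apply T x}"

lemma bounded_linear_scaleC: "bounded_linear (\<lambda>x. c *\<^sub>C x)"
  by (rule bounded_linear_intro [where K = "cmod c"])
    (auto intro!: ell2_eqI simp: algebra_simps)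

definition scaleC_op :: "complex \<Rightarrow> 'a op \<Rightarrow> 'a op"
  where "scaleC_op c T = Blinfun (\<lambda>x. c *\<^sub>C blinfun_apply T x)"

lemma scaleC_op_apply [simp]: "blinfun_apply (scaleC_op c T) x = c *\<^sub>C blinfun_apply T x"
  unfolding scaleC_op_def
  by (intro bounded_linear_Blinfun_apply [THEN fun_cong]
      bounded_linear_compose [OF bounded_linear_scaleC] blinfun.bounded_linear_right)

definition adj :: "'a op \<Rightarrow> 'a op"
  where "adj T = (THE S. \<forall>x y. cinner (blinfun_apply T x) y = cinner x (blinfun_apply S y))"

definition compact_ops :: "'a op set"
  where "compact_ops = {T \<in> bounded_ops. compact (closure (blinfun_apply T ` cball 0 1))}"

section \<open>Concrete unital C*-algebras\<close>

definition unital_cstar_algebra :: "'a op set \<Rightarrow> bool"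
  where "unital_cstar_algebra B \<longleftrightarrow>
    B \<subseteq> bounded_ops \<and> id_blinfun \<in> B \<and>
    (\<forall>X\<in>B. \<forall>Y\<in>B. X + Y \<in> B \<and> X o\<^sub>L Y \<in> B) \<and>
    (\<forall>X\<in>B. \<forall>c. scaleC_op c X \<in> B) \<and>
    (\<forall>X\<in>B. adj X \<in> B) \<and> closed B"

definition cstar_generated :: "'a op set \<Rightarrow> 'a op set"
  where "cstar_generated G = \<Inter>{B. unital_cstar_algebra B \<and> G \<subseteq> B}"

definition complex_linear_on :: "'a op set \<Rightarrow> ('a op \<Rightarrow> 'a op) \<Rightarrow> bool"
  where "complex_linear_on B F \<longleftrightarrow>
    (\<forall>X\<in>B. \<forall>Y\<in>B. F (X + Y) = F X + F Y) \<and>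
    (\<forall>X\<in>B. \<forall>c. F (scaleC_op c X) = scaleC_op c (F X))"

definition star_automorphism :: "'a op set \<Rightarrow> ('a op \<Rightarrow> 'a op) \<Rightarrow> bool"
  where "star_automorphism B \<alpha> \<longleftrightarrow>
    bij_betw \<alpha> B B \<and> complex_linear_on B \<alpha> \<and>
    (\<forall>X\<in>B. \<forall>Y\<in>B. \<alpha> (X o\<^sub>L Y) = \<alpha> X o\<^sub>L \<alpha> Y) \<and>
    (\<forall>X\<in>B. \<alpha> (adj X) = adj (\<alpha> X))"

definition cstar_dynamical_system :: "'a op set \<Rightarrow> ('a op \<Rightarrow> 'a op) \<Rightarrow> bool"
  where "cstar_dynamical_system B \<alpha> \<longleftrightarrow> unital_cstar_algebra B \<and> star_automorphism B \<alpha>"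

definition fixed_points :: "'a op set \<Rightarrow> ('a op \<Rightarrow> 'a op) \<Rightarrow> 'a op set"
  where "fixed_points B \<alpha> = {X \<in> B. \<alpha> X = X}"

definition dual_of :: "'a op set \<Rightarrow> ('a op \<Rightarrow> complex) set"
  where "dual_of B = {f.
    (\<forall>X\<in>B. \<forall>Y\<in>B. f (X + Y) = f X + f Y) \<and>
    (\<forall>X\<in>B. \<forall>c. f (scaleC_op c X) = c * f X) \<and>
    (\<exists>K. \<forall>X\<in>B. cmod (f X) \<le> K * norm X)}"

definition positive_in :: "'a op set \<Rightarrow> 'a op \<Rightarrow> bool"
  where "positive_in B X \<longleftrightarrow> (\<exists>Y\<in>B. X = adj Y o\<^sub>L Y)"

text \<open>By Tomiyama's theorem, contractivity and the projection property alone already imply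
  positivity and the bimodule property (and complete positivity).\<close>

definition conditional_expectation :: "'a op set \<Rightarrow> 'a op set \<Rightarrow> ('a op \<Rightarrow> 'a op) \<Rightarrow> bool"
  where "conditional_expectation B C F \<longleftrightarrow>
    C \<subseteq> B \<and> F ` B \<subseteq> C \<and> complex_linear_on B F \<and>
    (\<forall>Y\<in>C. F Y = Y) \<and>
    (\<forall>X\<in>B. norm (F X) \<le> norm X) \<and>
    (\<forall>X. positive_in B X \<longrightarrow> positive_in C (F X)) \<and>
    (\<forall>X\<in>B. \<forall>Y\<in>C. \<forall>Z\<in>C. F (Y o\<^sub>L X o\<^sub>L Z) = Y o\<^sub>L F X o\<^sub>L Z)"

definition invariant_conditional_expectation ::
    "'a op set \<Rightarrow> ('a op \<Rightarrow> 'a op) \<Rightarrow> ('a op \<Rightarrow> 'a op) \<Rightarrow> bool"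
  where "invariant_conditional_expectation B \<alpha> F \<longleftrightarrow>
    conditional_expectation B (fixed_points B \<alpha>) F \<and> (\<forall>X\<in>B. F (\<alpha> X) = F X)"

section \<open>The Boolean C*-algebra and its shift\<close>

text \<open>The index set of the Fock space is \<^typ>\<open>int option\<close>, with \<^term>\<open>None\<close> in the role of
  the vacuum index \<open>#\<close>.\<close>

definition matrix_unit :: "'a \<Rightarrow> 'a \<Rightarrow> 'a op"
  where "matrix_unit j k = Blinfun (\<lambda>x. cinner x (basis k) *\<^sub>C basis j)"

lemma matrix_unit_apply [simp]:
  "blinfun_apply (matrix_unit j k) x = cinner x (basis k) *\<^sub>C basis j"
proof -
  have "bounded_linear (\<lambda>x. cinner x (basis k) *\<^sub>C basis j)"
  proof (rule bounded_linear_intro [where K = "norm (basis j)"])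
    show "norm (cinner x (basis k) *\<^sub>C basis j) \<le> norm x * norm (basis j)" for x
      by (simp add: mult_right_mono cmod_coord_le_norm)
  qed (auto intro!: ell2_eqI simp: algebra_simps)
  then show ?thesis
    unfolding matrix_unit_def by (simp add: bounded_linear_Blinfun_apply)
qed

definition annihilation :: "int \<Rightarrow> int option op"
  where "annihilation i = matrix_unit None (Some i)"

definition vacuum_proj :: "int option op"
  where "vacuum_proj = matrix_unit None None"

definition boolean_cstar :: "int option op set"
  where "boolean_cstar = cstar_generated (range annihilation)"

lemma bij_map_option_shift: "bij (map_option (\<lambda>i::int. i - d))"
  by (rule bij_betw_byWitness [where f' = "map_option (\<lambda>i. i + d)"])
    (auto simp: option.map_comp comp_def option.map_ident)

lift_definition translate :: "int \<Rightarrow> int option ell2 \<Rightarrow> int option ell2"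
  is "\<lambda>d x k. x (map_option (\<lambda>i. i - d) k)"
  by (subst summable_on_reindex_bij_betw [OF bij_map_option_shift, where f = "\<lambda>k. (cmod (_ k))\<^sup>2"])

lemma coord_translate [simp]: "coord (translate d x) k = coord x (map_option (\<lambda>i. i - d) k)"
  by transfer simp

lemma norm_translate [simp]: "norm (translate d x) = norm x"
  by transfer
    (simp add: infsum_reindex_bij_betw [OF bij_map_option_shift, where f = "\<lambda>k. (cmod (_ k))\<^sup>2"])

definition translation :: "int \<Rightarrow> int option op"
  where "translation d = Blinfun (translate d)"

lemma translation_apply [simp]: "blinfun_apply (translation d) x = translate d x"
  unfolding translation_def
  by (rule bounded_linear_Blinfun_apply [THEN fun_cong])
    (rule bounded_linear_intro [where K = 1], auto intro!: ell2_eqI)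

definition shift :: "int option op \<Rightarrow> int option op"
  where "shift X = translation 1 o\<^sub>L X o\<^sub>L adj (translation 1)"

text \<open>\<open>E(A + bI) = \<langle>A e\<^sub>#, e\<^sub>#\<rangle> P\<^sub># + bI\<close> for compact \<open>A\<close>; the decomposition \<open>A + bI\<close> is unique
  because the space is infinite-dimensional, see \<open>boolean_expectation_eq\<close> below.\<close>

definition boolean_expectation :: "int option op \<Rightarrow> int option op"
  where "boolean_expectation X = (THE Y. \<exists>A\<in>compact_ops. \<exists>b.
    X = A + scaleC_op b id_blinfun \<and>
    Y = scaleC_op (cinner (blinfun_apply A (basis None)) (basis None)) vacuum_proj
      + scaleC_op b id_blinfun)"

definition uniquely_mixing_wrt_fixed_points ::
    "'a op set \<Rightarrow> ('a op \<Rightarrow> 'a op) \<Rightarrow> ('a op \<Rightarrow> 'a op) \<Rightarrow> bool"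
  where "uniquely_mixing_wrt_fixed_points B \<alpha> E \<longleftrightarrow>
    invariant_conditional_expectation B \<alpha> E \<and>
    (\<forall>X\<in>B. \<forall>f\<in>dual_of B. (\<lambda>n. f ((\<alpha> ^^ n) X)) \<longlonglongrightarrow> f (E X))"

section \<open>Adjoint of the shift unitary and well-definedness of the expectation\<close>

lemma cinner_basis_left [simp]: "cinner (basis k) y = cnj (coord y k)"
proof transfer
  fix y :: "'a \<Rightarrow> complex" and k
  have "(\<Sum>\<^sub>\<infinity>i. (if i = k then 1 else 0) * cnj (y i)) = (\<Sum>\<^sub>\<infinity>i\<in>{k}. (if i = k then 1 else 0) * cnj (y i))"
    by (rule infsum_cong_neutral) auto
  then show "(\<Sum>\<^sub>\<infinity>i. (if i = k then 1 else 0) * cnj (y i)) = cnj (y k)" by simp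
qed

lemma adj_eqI:
  assumes "\<And>x y. cinner (blinfun_apply T x) y = cinner x (blinfun_apply S y)"
  shows "adj T = S"
  unfolding adj_def
proof (rule the_equality)
  fix S' assume S': "\<forall>x y. cinner (blinfun_apply T x) y = cinner x (blinfun_apply S' y)"
  show "S' = S"
  proof (rule blinfun_eqI, rule ell2_eqI)
    fix y k
    have "cinner (basis k) (blinfun_apply S' y) = cinner (basis k) (blinfun_apply S y)"
      using assms S' by metis
    then show "coord (blinfun_apply S' y) k = coord (blinfun_apply S y) k" by simp
  qed
qed (use assms in blast)

lemma adj_translation: "adj (translation d) = translation (- d)"
proof (rule adj_eqI, unfold translation_apply)
  fix x y
  show "cinner (translate d x) y = cinner x (translate (- d) y)"
    unfolding cinner.rep_eq coord_translate
    by (subst infsum_reindex_bij_betw [OF bij_map_option_shift [of "- d"], symmetric])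
      (simp add: option.map_comp comp_def option.map_ident)
qed

lemma translation_basis:
  "blinfun_apply (translation d) (basis None) = basis None"
  "blinfun_apply (translation d) (basis (Some i)) = basis (Some (i + d))"
  unfolding translation_apply
  by (rule ell2_eqI, auto simp: map_option_case split: option.splits)+

lemma shift_annihilation: "shift (annihilation i) = annihilation (i + 1)"
  unfolding shift_def adj_translation annihilation_def
  by (rule blinfun_eqI, rule ell2_eqI)
    (auto simp: map_option_case split: option.splits)

lemma compact_ops_scalar_unique:
  fixes A A' :: "'a op"
  assumes inf: "infinite (UNIV :: 'a set)"
    and A: "A \<in> compact_ops" and A': "A' \<in> compact_ops"
    and eq: "A + scaleC_op b id_blinfun = A' + scaleC_op b' id_blinfun"
  shows "b = b'"
proof (rule ccontr)
  assume ne: "b \<noteq> b'"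
  obtain e :: "nat \<Rightarrow> 'a" where e: "inj e"
    using inf infinite_countable_subset by blast
  define v where "v n = (basis (e n) :: 'a ell2)" for n
  have nv: "norm (v n) \<le> 1" for n
  proof -
    have "(\<Sum>\<^sub>\<infinity>i. (cmod (coord (v n) i))\<^sup>2) = (\<Sum>\<^sub>\<infinity>i\<in>{e n}. (cmod (coord (v n) i))\<^sup>2)"
      by (rule infsum_cong_neutral) (auto simp: v_def)
    then show ?thesis by (simp add: norm_ell2.rep_eq v_def)
  qed
  have in_cl: "blinfun_apply T (v n) \<in> closure (blinfun_apply T ` cball 0 1)" for T :: "'a op" and n
    using closure_subset nv by (auto intro!: subsetD [OF closure_subset] imageI)
  have "seq_compact (closure (blinfun_apply A ` cball 0 1))"
    using A by (simp add: compact_ops_def compact_eq_seq_compact_metric)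
  then obtain r l where r: "strict_mono r" "(\<lambda>n. blinfun_apply A (v (r n))) \<longlonglongrightarrow> l"
    using seq_compactE [of _ "\<lambda>n. blinfun_apply A (v n)"] in_cl [of A] unfolding comp_def by metis
  have "seq_compact (closure (blinfun_apply A' ` cball 0 1))"
    using A' by (simp add: compact_ops_def compact_eq_seq_compact_metric)
  then obtain s l' where s: "strict_mono s" "(\<lambda>n. blinfun_apply A' (v (r (s n)))) \<longlonglongrightarrow> l'"
    using seq_compactE [of _ "\<lambda>n. blinfun_apply A' (v (r n))"] in_cl [of A'] unfolding comp_def by metis
  have "(\<lambda>n. blinfun_apply A (v (r (s n)))) \<longlonglongrightarrow> l"
    using LIMSEQ_subseq_LIMSEQ [OF r(2) s(1)] by (simp add: comp_def)
  then have lim: "(\<lambda>n. blinfun_apply A' (v (r (s n))) - blinfun_apply A (v (r (s n)))) \<longlonglongrightarrow> l' - l"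
    using s(2) by (intro tendsto_diff)
  have d: "blinfun_apply A' x - blinfun_apply A x = (b - b') *\<^sub>C x" for x
  proof (rule ell2_eqI)
    fix i
    have "coord (blinfun_apply (A + scaleC_op b id_blinfun) x) i
        = coord (blinfun_apply (A' + scaleC_op b' id_blinfun) x) i" by (simp add: eq)
    then show "coord (blinfun_apply A' x - blinfun_apply A x) i = coord ((b - b') *\<^sub>C x) i"
      by (simp add: blinfun.add_left algebra_simps)
  qed
  have "Cauchy (\<lambda>n. (b - b') *\<^sub>C v (r (s n)))"
    using lim by (auto simp: d intro: LIMSEQ_imp_Cauchy)
  then obtain M where M: "\<And>m n. m \<ge> M \<Longrightarrow> n \<ge> M \<Longrightarrow>
      dist ((b - b') *\<^sub>C v (r (s m))) ((b - b') *\<^sub>C v (r (s n))) < cmod (b - b')"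
    unfolding Cauchy_def using ne by (metis right_minus_eq zero_less_norm_iff)
  have "r (s M) \<noteq> r (s (Suc M))"
    using r(1) s(1) by (metis n_not_Suc_n strict_mono_eq)
  then have "e (r (s M)) \<noteq> e (r (s (Suc M)))" using e by (simp add: inj_eq)
  then have "cmod (b - b')
    = cmod (coord ((b - b') *\<^sub>C v (r (s M)) - (b - b') *\<^sub>C v (r (s (Suc M)))) (e (r (s M))))"
    by (simp add: v_def)
  also have "\<dots> \<le> dist ((b - b') *\<^sub>C v (r (s M))) ((b - b') *\<^sub>C v (r (s (Suc M))))"
    unfolding dist_norm by (rule cmod_coord_le_norm)
  also have "\<dots> < cmod (b - b')" by (rule M) auto
  finally show False by simp
qed

lemma boolean_expectation_eq:
  assumes A: "A \<in> compact_ops"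
  shows "boolean_expectation (A + scaleC_op b id_blinfun) =
    scaleC_op (cinner (blinfun_apply A (basis None)) (basis None)) vacuum_proj
      + scaleC_op b id_blinfun"
  unfolding boolean_expectation_def
proof (rule the_equality)
  fix Y
  assume "\<exists>A'\<in>compact_ops. \<exists>b'. A + scaleC_op b id_blinfun = A' + scaleC_op b' id_blinfun \<and>
    Y = scaleC_op (cinner (blinfun_apply A' (basis None)) (basis None)) vacuum_proj
      + scaleC_op b' id_blinfun"
  then obtain A' b' where A': "A' \<in> compact_ops"
    and eq: "A + scaleC_op b id_blinfun = A' + scaleC_op b' id_blinfun"
    and Y: "Y = scaleC_op (cinner (blinfun_apply A' (basis None)) (basis None)) vacuum_proj
      + scaleC_op b' id_blinfun" by blast
  have "b = b'"
    by (rule compact_ops_scalar_unique [OF _ A A' eq]) (simp add: infinite_UNIV_char_0)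
  with eq Y show "Y = scaleC_op (cinner (blinfun_apply A (basis None)) (basis None)) vacuum_proj
      + scaleC_op b id_blinfun" by simp
qed (use A in blast)

end

theory Submission
  imports Defs
begin

text \<open>The algebra is the norm closure of the complex span of \<open>I\<close> and the matrix units \<open>E\<^bsub>jk\<^esub>\<close>.
  Along this span the diagonal entries \<open>\<langle>X e\<^sub>n, e\<^sub>n\<rangle>\<close> converge to the scalar part \<open>b\<close> of
  \<open>X = A + bI\<close>, and \<open>|b| \<le> \<parallel>X\<parallel>\<close> lets this pass to the closure, so \<open>E X\<close> is the diagonal operator with
  entry \<open>\<langle>X e\<^sub>#, e\<^sub>#\<rangle>\<close> at \<open>#\<close> and \<open>lim \<langle>X e\<^sub>n, e\<^sub>n\<rangle>\<close> elsewhere; the properties of a conditional expectation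
  follow by passing to the limit. For a functional \<open>f\<close> the values on the orbit of a matrix unit
  \<open>E\<^bsub>jk\<^esub> \<noteq> P\<^sub>#\<close> are square-summable, hence null, and contractivity extends the convergence
  \<open>f (\<alpha>\<^sup>n X) \<longlonglongrightarrow> f (E X)\<close> to the closure. Since functionals separate points, the fixed points are
  exactly the range of \<open>E\<close>, and applying mixing to \<open>f \<circ> F\<close> gives uniqueness.\<close>

section \<open>Hilbert space and adjoints\<close>

text \<open>Cauchy-Schwarz on a finite set of coordinates bounds the partial sums by a constant
  independent of the set. The same bound yields absolute summability, without which
  \<open>infsum\<close> returns its default value, and the norm inequality.\<close>

lemma cinner_abs_summable: "(\<lambda>i. cmod (coord x i * cnj (coord y i))) summable_on UNIV"
  and norm_cinner_le: "cmod (cinner x y) \<le> norm x * norm y"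
proof -
  have b: "(\<Sum>i\<in>F. cmod (coord x i * cnj (coord y i))) \<le> norm x * norm y" if F: "finite F" for F
  proof -
    have "(\<Sum>i\<in>F. cmod (coord x i * cnj (coord y i)))
        = (\<Sum>i\<in>F. \<bar>cmod (coord x i)\<bar> * \<bar>cmod (coord y i)\<bar>)"
      by (simp add: norm_mult)
    also have "\<dots> \<le> L2_set (\<lambda>i. cmod (coord x i)) F * L2_set (\<lambda>i. cmod (coord y i)) F"
      by (rule L2_set_mult_ineq)
    also have "\<dots> \<le> norm x * norm y"
      by (intro mult_mono L2_set_le_norm F) (auto simp: L2_set_nonneg)
    finally show ?thesis .
  qed
  show s: "(\<lambda>i. cmod (coord x i * cnj (coord y i))) summable_on UNIV"
    by (rule nonneg_bdd_above_summable_on)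
      (auto intro!: bdd_aboveI2 [where M = "norm x * norm y"] b)
  have "cmod (cinner x y) \<le> (\<Sum>\<^sub>\<infinity>i. cmod (coord x i * cnj (coord y i)))"
    unfolding cinner.rep_eq by (rule norm_infsum_bound [OF s])
  also have "\<dots> \<le> norm x * norm y"
    by (rule infsum_le_finite_sums [OF s]) (use b in auto)
  finally show "cmod (cinner x y) \<le> norm x * norm y" .
qed

lemma cinner_summable: "(\<lambda>i. coord x i * cnj (coord y i)) summable_on UNIV"
  by (rule abs_summable_summable [OF cinner_abs_summable])

lemma cinner_add_left: "cinner (x + y) z = cinner x z + cinner y z"
  unfolding cinner.rep_eq
  by (simp add: distrib_right infsum_add cinner_summable)

lemma cinner_scaleC_left: "cinner (c *\<^sub>C x) y = c * cinner x y"
  unfolding cinner.rep_eq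
  by (simp add: mult.assoc infsum_cmult_right')

lemma cinner_commute: "cinner y x = cnj (cinner x y)"
  unfolding cinner.rep_eq infsum_cnj [symmetric] by (simp add: mult.commute)

lemma cinner_add_right: "cinner x (y + z) = cinner x y + cinner x z"
  by (metis cinner_add_left cinner_commute complex_cnj_add)

lemma cinner_scaleC_right: "cinner x (c *\<^sub>C y) = cnj c * cinner x y"
  by (metis cinner_scaleC_left cinner_commute complex_cnj_mult)

lemma scaleR_eq_scaleC: "r *\<^sub>R x = complex_of_real r *\<^sub>C x" for x :: "'a ell2"
  by (rule scaleR_ell2_def)

lemma norm_sq_eq_infsum: "(norm x)\<^sup>2 = (\<Sum>\<^sub>\<infinity>i. (cmod (coord x i))\<^sup>2)"
  by (simp add: norm_ell2.rep_eq infsum_nonneg)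

lemma cinner_self: "cinner x x = complex_of_real ((norm x)\<^sup>2)"
proof -
  have "((\<lambda>i. complex_of_real ((cmod (coord x i))\<^sup>2)) has_sum complex_of_real ((norm x)\<^sup>2)) UNIV"
    unfolding norm_sq_eq_infsum has_sum_of_real_iff by (rule has_sum_infsum [OF ell2_summable])
  then show ?thesis
    unfolding cinner.rep_eq by (intro infsumI) (simp add: complex_norm_square del: of_real_power)
qed

lemma bounded_linear_cinner_left: "bounded_linear (\<lambda>x. cinner x y)"
  by (rule bounded_linear_intro [where K = "norm y"])
    (simp_all add: cinner_add_left scaleR_eq_scaleC cinner_scaleC_left norm_cinner_le scaleR_conv_of_real)

lemma bounded_linear_cinner_right: "bounded_linear (cinner x)"
  by (rule bounded_linear_intro [where K = "norm x"])
    (simp_all add: cinner_add_right scaleR_eq_scaleC cinner_scaleC_right scaleR_conv_of_real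
      norm_cinner_le mult.commute [of _ "norm x"])

lemma norm_leI:
  assumes "\<And>F. finite F \<Longrightarrow> L2_set (\<lambda>i. cmod (coord x i)) F \<le> C"
  shows "norm x \<le> C"
  unfolding norm_ell2.rep_eq by (rule sq_summableI(2) [OF assms])

lemma norm_le_coord:
  assumes "\<And>i. cmod (coord x i) \<le> M * cmod (coord y i)" "0 \<le> M"
  shows "norm x \<le> M * norm y"
proof (rule norm_leI)
  fix F :: "'a set" assume F: "finite F"
  have "L2_set (\<lambda>i. cmod (coord x i)) F \<le> L2_set (\<lambda>i. M * cmod (coord y i)) F"
    by (intro L2_set_mono assms) simp
  also have "\<dots> = M * L2_set (\<lambda>i. cmod (coord y i)) F"
    by (simp add: L2_set_right_distrib assms)
  also have "\<dots> \<le> M * norm y" by (intro mult_left_mono L2_set_le_norm F assms)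
  finally show "L2_set (\<lambda>i. cmod (coord x i)) F \<le> M * norm y" .
qed

lemma coord_sum: "coord (sum g F) i = (\<Sum>k\<in>F. coord (g k) i)"
  by (induction F rule: infinite_finite_induct) auto

lemma coord_sum_basis:
  "finite F \<Longrightarrow> coord (\<Sum>k\<in>F. c k *\<^sub>C basis k) i = (if i \<in> F then c i else 0)"
  by (simp add: coord_sum if_distrib cong: if_cong)

lemma norm_sum_basis:
  assumes F: "finite F"
  shows "norm (\<Sum>k\<in>F. c k *\<^sub>C basis k) = L2_set (\<lambda>k. cmod (c k)) F"
proof -
  have "(\<Sum>\<^sub>\<infinity>i. (cmod (coord (\<Sum>k\<in>F. c k *\<^sub>C basis k) i))\<^sup>2) = (\<Sum>\<^sub>\<infinity>i\<in>F. (cmod (c i))\<^sup>2)"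
    by (rule infsum_cong_neutral) (auto simp: coord_sum_basis F)
  then show ?thesis by (simp add: norm_ell2.rep_eq L2_set_def F)
qed

lemma norm_basis [simp]: "norm (basis k) = 1"
  using norm_sum_basis [of "{k}" "\<lambda>_. 1"]
  by (simp add: L2_set_def)

text \<open>Truncating \<open>x\<close> to a finite set of coordinates leaves an error whose square
  is the tail of a convergent sum. All complex multiples of basis vectors are listed as generators
  because \<open>span\<close> is the real span.\<close>

lemma closure_span_basis: "closure (span {c *\<^sub>C basis i |c i. True}) = (UNIV :: 'a ell2 set)"
proof (intro equalityI subset_UNIV subsetI)
  fix x :: "'a ell2"
  show "x \<in> closure (span {c *\<^sub>C basis i |c i. True})"
    unfolding closure_approachable
  proof (intro allI impI)
    fix e :: real assume e: "0 < e"
    have s: "((\<lambda>i. (cmod (coord x i))\<^sup>2) has_sum (norm x)\<^sup>2) UNIV"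
      unfolding norm_sq_eq_infsum by (rule has_sum_infsum [OF ell2_summable])
    have "\<forall>\<^sub>F F in finite_subsets_at_top UNIV.
        dist (\<Sum>i\<in>F. (cmod (coord x i))\<^sup>2) ((norm x)\<^sup>2) < e\<^sup>2"
      by (rule tendstoD [OF s [unfolded has_sum_def]]) (use e in simp)
    then obtain F where F: "finite F"
      and d: "dist (\<Sum>i\<in>F. (cmod (coord x i))\<^sup>2) ((norm x)\<^sup>2) < e\<^sup>2"
      unfolding eventually_finite_subsets_at_top by blast
    define y where "y = (\<Sum>k\<in>F. coord x k *\<^sub>C basis k)"
    have "((norm (y - x))\<^sup>2) = (\<Sum>\<^sub>\<infinity>i\<in>-F. (cmod (coord x i))\<^sup>2)"
      unfolding norm_sq_eq_infsum
      by (rule infsum_cong_neutral) (auto simp: y_def coord_sum_basis F)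
    also have "\<dots> = (norm x)\<^sup>2 - (\<Sum>i\<in>F. (cmod (coord x i))\<^sup>2)"
    proof -
      have "((\<lambda>i. (cmod (coord x i))\<^sup>2) has_sum ((norm x)\<^sup>2 - (\<Sum>i\<in>F. (cmod (coord x i))\<^sup>2))) (UNIV - F)"
        by (rule has_sum_Diff [OF s has_sum_finite [OF F]]) simp
      then show ?thesis by (simp add: infsumI Compl_eq_Diff_UNIV)
    qed
    also have "\<dots> < e\<^sup>2" using d by (simp add: dist_real_def)
    finally have "norm (y - x) < e" using e by (simp add: power2_less_imp_less)
    moreover have "y \<in> span {c *\<^sub>C basis i |c i. True}"
      unfolding y_def by (intro span_sum span_base) blast
    ultimately show "\<exists>y\<in>span {c *\<^sub>C basis i |c i. True}. dist y x < e"
      unfolding dist_norm by blast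
  qed
qed

text \<open>The kernel of \<open>f - g\<close> is a closed real subspace containing a dense span.
  Bounded linearity is meant over the reals, so agreement is demanded on every complex multiple of a
  basis vector; operators and functionals are both covered.\<close>

lemma bounded_linear_eq_on_basis:
  fixes f g :: "'a ell2 \<Rightarrow> 'b::real_normed_vector"
  assumes f: "bounded_linear f" and g: "bounded_linear g"
    and eq: "\<And>c k. f (c *\<^sub>C basis k) = g (c *\<^sub>C basis k)"
  shows "f x = g x"
proof -
  define h where "h x = f x - g x" for x
  interpret h: bounded_linear h unfolding h_def by (rule bounded_linear_sub [OF f g])
  have "span {c *\<^sub>C basis i |c i. True} \<subseteq> {x. h x = 0}"
    by (rule span_minimal) (auto simp: subspace_def h.add h.scaleR h.zero, simp add: h_def eq)
  moreover have "closed {x. h x = 0}"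
    by (intro closed_Collect_eq continuous_intros h.continuous_on)
  ultimately have "closure (span {c *\<^sub>C basis i |c i. True}) \<subseteq> {x. h x = 0}"
    by (rule closure_minimal)
  then have "h x = 0" unfolding closure_span_basis by blast
  then show ?thesis by (simp add: h_def)
qed

section \<open>Complex-linear operators and their adjoints\<close>

lemma bounded_ops_scaleC:
  "T \<in> bounded_ops \<Longrightarrow> blinfun_apply T (c *\<^sub>C x) = c *\<^sub>C blinfun_apply T x"
  by (simp add: bounded_ops_def)

lemma bounded_ops_eqI:
  assumes "S \<in> bounded_ops" "T \<in> bounded_ops"
    and "\<And>j k. coord (blinfun_apply S (basis k)) j = coord (blinfun_apply T (basis k)) j"
  shows "S = T"
proof (rule blinfun_eqI, rule bounded_linear_eq_on_basis
    [of "blinfun_apply S" "blinfun_apply T"])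
  have "blinfun_apply S (basis k) = blinfun_apply T (basis k)" for k
    by (rule ell2_eqI) (rule assms)
  then show "blinfun_apply S (c *\<^sub>C basis k) = blinfun_apply T (c *\<^sub>C basis k)" for c k
    by (simp add: bounded_ops_scaleC [OF assms(1)] bounded_ops_scaleC [OF assms(2)])
qed (rule blinfun.bounded_linear_right)+

lemma scaleC_distribs:
  "c *\<^sub>C (x + y) = c *\<^sub>C x + c *\<^sub>C y" "(c + d) *\<^sub>C x = c *\<^sub>C x + d *\<^sub>C x"
  "c *\<^sub>C d *\<^sub>C x = (c * d) *\<^sub>C x" "c *\<^sub>C (x - y) = c *\<^sub>C x - c *\<^sub>C y" "1 *\<^sub>C x = x"
  by (rule ell2_eqI, simp add: algebra_simps)+

text \<open>The definite description in \<open>adj\<close> means something only once an adjoint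
  exists. Its coordinates are forced: the \<open>k\<close>-th coordinate of the image of
  \<open>y\<close> must be \<open>cinner y (blinfun_apply T (basis k))\<close>. What has to be shown
  is that this family is square-summable.\<close>

lemma bounded_ops_adjoint_exists:
  assumes T: "T \<in> bounded_ops"
  shows "\<exists>S\<in>bounded_ops. norm S \<le> norm T \<and>
    (\<forall>x y. cinner (blinfun_apply T x) y = cinner x (blinfun_apply S y))"
proof -
  have L: "L2_set (\<lambda>k. cmod (cinner y (blinfun_apply T (basis k)))) F \<le> norm T * norm y"
    if F: "finite F" for y F
  proof -
    define c where "c k = cinner y (blinfun_apply T (basis k))" for k
    define l where "l = L2_set (\<lambda>k. cmod (c k)) F"
    \<comment> \<open>This test vector turns the pairing with \<open>y\<close> into the sum of the
      squares of the moduli of \<open>c k\<close>, that is into \<open>l\<close> squared, while its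
      own norm is \<open>l\<close>. Boundedness of \<open>T\<close> then gives
      \<open>l * l \<le> (norm T * norm y) * l\<close>, and \<open>l\<close> is cancelled.\<close>
    define v where "v = (\<Sum>k\<in>F. c k *\<^sub>C basis k)"
    have "cinner y (blinfun_apply T v) = (\<Sum>k\<in>F. cnj (c k) * c k)"
      unfolding v_def blinfun.sum_right linear_sum [OF bounded_linear.linear [OF bounded_linear_cinner_right]]
      by (intro sum.cong refl) (simp add: bounded_ops_scaleC [OF T] cinner_scaleC_right c_def)
    also have "\<dots> = complex_of_real (l\<^sup>2)"
      by (simp add: l_def L2_set_def sum_nonneg mult.commute [of "cnj _"] complex_norm_square del: of_real_power)
    finally have "l\<^sup>2 = cmod (cinner y (blinfun_apply T v))"
      by (simp add: norm_power l_def L2_set_nonneg)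
    also have "\<dots> \<le> norm y * (norm T * norm v)"
      by (rule order_trans [OF norm_cinner_le]) (intro mult_left_mono norm_blinfun, simp)
    also have "norm v = l" unfolding v_def l_def by (rule norm_sum_basis [OF F])
    finally have "l * l \<le> (norm T * norm y) * l" by (simp add: power2_eq_square mult_ac)
    moreover have "0 \<le> l" by (simp add: l_def L2_set_nonneg)
    ultimately have "l \<le> norm T * norm y"
      by (cases "l = 0") (simp_all add: mult_le_cancel_right)
    then show ?thesis by (simp add: l_def c_def)
  qed
  define s where "s y = Abs_ell2 (\<lambda>k. cinner y (blinfun_apply T (basis k)))" for y
  have cs: "coord (s y) k = cinner y (blinfun_apply T (basis k))" for y k
    unfolding s_def by (subst Abs_ell2_inverse) (use sq_summableI(1) [OF L] in auto)
  have ns: "norm (s y) \<le> norm T * norm y" for y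
    by (rule norm_leI) (use L in \<open>simp add: cs\<close>)
  have bl: "bounded_linear s"
    by (rule bounded_linear_intro [where K = "norm T"])
      (auto intro!: ell2_eqI ns simp: cs cinner_add_left scaleR_eq_scaleC cinner_scaleC_left
        mult.commute [of _ "norm T"])
  define S where "S = Blinfun s"
  have S: "blinfun_apply S y = s y" for y
    unfolding S_def by (simp add: bounded_linear_Blinfun_apply bl)
  show ?thesis
  proof (intro bexI conjI allI)
    show "S \<in> bounded_ops"
      by (auto simp: bounded_ops_def S cs cinner_scaleC_left intro!: ell2_eqI)
    show "norm S \<le> norm T" by (rule norm_blinfun_bound) (simp_all add: S ns)
    show "cinner (blinfun_apply T x) y = cinner x (blinfun_apply S y)" for x y
    proof (rule bounded_linear_eq_on_basis [where x = x])
      show "bounded_linear (\<lambda>x. cinner (blinfun_apply T x) y)"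
        by (intro bounded_linear_compose [OF bounded_linear_cinner_left]
            blinfun.bounded_linear_right)
      show "cinner (blinfun_apply T (c *\<^sub>C basis k)) y = cinner (c *\<^sub>C basis k) (blinfun_apply S y)"
        for c k
        by (simp add: bounded_ops_scaleC [OF T] cinner_scaleC_left S cs
            cinner_commute [of y "blinfun_apply T (basis k)"])
    qed (rule bounded_linear_cinner_left)
  qed
qed

lemma
  assumes "T \<in> bounded_ops"
  shows adj_bounded_ops: "adj T \<in> bounded_ops"
    and norm_adj_le: "norm (adj T) \<le> norm T"
    and cinner_adj: "cinner (blinfun_apply T x) y = cinner x (blinfun_apply (adj T) y)"
proof -
  obtain S where "S \<in> bounded_ops" "norm S \<le> norm T"
    "\<And>x y. cinner (blinfun_apply T x) y = cinner x (blinfun_apply S y)"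
    using bounded_ops_adjoint_exists [OF assms] by blast
  moreover from this have "adj T = S" by (intro adj_eqI)
  ultimately show "adj T \<in> bounded_ops" "norm (adj T) \<le> norm T"
    "cinner (blinfun_apply T x) y = cinner x (blinfun_apply (adj T) y)" by blast+
qed

lemma bounded_ops_id: "id_blinfun \<in> bounded_ops"
  and bounded_ops_add: "X \<in> bounded_ops \<Longrightarrow> Y \<in> bounded_ops \<Longrightarrow> X + Y \<in> bounded_ops"
  and bounded_ops_diff: "X \<in> bounded_ops \<Longrightarrow> Y \<in> bounded_ops \<Longrightarrow> X - Y \<in> bounded_ops"
  and bounded_ops_compose: "X \<in> bounded_ops \<Longrightarrow> Y \<in> bounded_ops \<Longrightarrow> X o\<^sub>L Y \<in> bounded_ops"
  and bounded_ops_scaleC_op: "X \<in> bounded_ops \<Longrightarrow> scaleC_op c X \<in> bounded_ops"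
  and matrix_unit_bounded_ops: "matrix_unit j k \<in> bounded_ops"
  and translation_bounded_ops: "translation d \<in> bounded_ops"
  by (simp_all add: bounded_ops_def blinfun.add_left blinfun.diff_left scaleC_distribs)
    (rule allI ell2_eqI | simp add: mult.commute)+

lemma adj_id: "adj id_blinfun = id_blinfun"
  by (rule adj_eqI) simp

lemma adj_add:
  "X \<in> bounded_ops \<Longrightarrow> Y \<in> bounded_ops \<Longrightarrow> adj (X + Y) = adj X + adj Y"
  by (rule adj_eqI) (simp add: blinfun.add_left cinner_add_left cinner_add_right cinner_adj)

lemma adj_scaleC_op: "X \<in> bounded_ops \<Longrightarrow> adj (scaleC_op c X) = scaleC_op (cnj c) (adj X)"
  by (rule adj_eqI) (simp add: cinner_scaleC_left cinner_scaleC_right cinner_adj)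

lemma scaleR_eq_scaleC_op: "r *\<^sub>R X = scaleC_op (complex_of_real r) X"
  by (rule blinfun_eqI) (simp add: blinfun.scaleR_left scaleR_eq_scaleC)

lemma bounded_linear_scaleC_left: "bounded_linear (\<lambda>c. c *\<^sub>C x)"
  by (rule bounded_linear_intro [where K = "norm x"])
    (simp_all add: scaleC_distribs scaleR_eq_scaleC scaleR_conv_of_real)

lemma norm_scaleC_op_le: "norm (scaleC_op c T) \<le> cmod c * norm T"
proof (rule norm_blinfun_bound)
  show "norm (blinfun_apply (scaleC_op c T) x) \<le> cmod c * norm T * norm x" for x
    using mult_left_mono [OF norm_blinfun [of T x], of "cmod c"] by (simp add: mult.assoc)
qed simp

lemma scaleC_op_add: "scaleC_op c (S + T) = scaleC_op c S + scaleC_op c T"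
  by (rule blinfun_eqI) (simp add: blinfun.add_left scaleC_distribs)

lemma scaleC_op_add_left: "scaleC_op (c + d) T = scaleC_op c T + scaleC_op d T"
  by (rule blinfun_eqI) (simp add: blinfun.add_left scaleC_distribs)

lemma scaleC_op_scaleC_op: "scaleC_op c (scaleC_op d T) = scaleC_op (c * d) T"
  by (rule blinfun_eqI) (simp add: scaleC_distribs)

lemma scaleC_op_one: "scaleC_op 1 T = T"
  by (rule blinfun_eqI) (simp add: scaleC_distribs)

lemma bounded_linear_scaleC_op: "bounded_linear (scaleC_op c)"
proof (rule bounded_linear_intro [where K = "cmod c"])
  show "norm (scaleC_op c T) \<le> norm T * cmod c" for T :: "'a op"
    using norm_scaleC_op_le by (simp add: mult.commute)
qed (simp_all only: scaleC_op_add scaleR_eq_scaleC_op scaleC_op_scaleC_op mult.commute)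

lemma bounded_linear_scaleC_op_left: "bounded_linear (\<lambda>c. scaleC_op c T)"
  by (rule bounded_linear_intro [where K = "norm T"])
    (simp_all only: scaleC_op_add_left scaleR_eq_scaleC_op scaleC_op_scaleC_op scaleR_conv_of_real
      norm_scaleC_op_le)

lemma scaleC_op_zero [simp]: "scaleC_op c 0 = 0" "scaleC_op 0 T = 0"
  by (rule linear_0 [OF bounded_linear.linear [OF bounded_linear_scaleC_op]],
      rule linear_0 [OF bounded_linear.linear [OF bounded_linear_scaleC_op_left]])

lemma adj_zero: "adj 0 = 0"
  by (rule adj_eqI) (simp add: cinner.rep_eq)

lemma adj_scaleR: "X \<in> bounded_ops \<Longrightarrow> adj (r *\<^sub>R X) = r *\<^sub>R adj X"
  by (simp add: scaleR_eq_scaleC_op adj_scaleC_op)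

lemma adj_diff:
  assumes "X \<in> bounded_ops" "Y \<in> bounded_ops"
  shows "adj (X - Y) = adj X - adj Y"
  using adj_add [OF bounded_ops_diff [OF assms] assms(2)] by simp

lemma adj_compose:
  "X \<in> bounded_ops \<Longrightarrow> Y \<in> bounded_ops \<Longrightarrow> adj (X o\<^sub>L Y) = adj Y o\<^sub>L adj X"
  by (rule adj_eqI) (simp add: cinner_adj)

lemma adj_matrix_unit: "adj (matrix_unit j k) = matrix_unit k j"
  by (rule adj_eqI) (simp add: cinner_scaleC_left cinner_scaleC_right mult.commute)

text \<open>Complex linearity is an intersection, over all scalars and vectors, of zero sets of
  norm-continuous maps of the operator.\<close>

lemma closed_bounded_ops: "closed (bounded_ops :: 'a op set)"
proof -
  have "bounded_ops = (\<Inter>c. \<Inter>x. {T :: 'a op. blinfun_apply T (c *\<^sub>C x) - c *\<^sub>C blinfun_apply T x = 0})"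
    by (auto simp: bounded_ops_def)
  also have "closed \<dots>"
    by (intro closed_INT ballI closed_Collect_eq continuous_intros
        bounded_linear.continuous_on [OF bounded_linear_scaleC])
  finally show ?thesis .
qed

section \<open>Generated C*-algebras\<close>

lemma unital_cstar_algebra_bounded_ops: "unital_cstar_algebra bounded_ops"
  unfolding unital_cstar_algebra_def
  by (auto intro: bounded_ops_id bounded_ops_add bounded_ops_compose bounded_ops_scaleC_op
      adj_bounded_ops closed_bounded_ops)

lemma unital_cstar_algebraD:
  assumes "unital_cstar_algebra B"
  shows "B \<subseteq> bounded_ops" "id_blinfun \<in> B"
    and "\<And>X Y. X \<in> B \<Longrightarrow> Y \<in> B \<Longrightarrow> X + Y \<in> B"
    and "\<And>X Y. X \<in> B \<Longrightarrow> Y \<in> B \<Longrightarrow> X o\<^sub>L Y \<in> B"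
    and "\<And>X c. X \<in> B \<Longrightarrow> scaleC_op c X \<in> B"
    and "\<And>X. X \<in> B \<Longrightarrow> adj X \<in> B" and "closed B"
  using assms unfolding unital_cstar_algebra_def by simp_all

text \<open>An intersection of unital C*-algebras inherits each closure property. The hypothesis
  makes \<open>bounded_ops\<close> a member of the intersected family, which keeps the intersection
  among the complex-linear operators.\<close>

lemma unital_cstar_algebra_generated:
  assumes "G \<subseteq> bounded_ops"
  shows "unital_cstar_algebra (cstar_generated G)"
proof -
  have iff: "X \<in> cstar_generated G \<longleftrightarrow> (\<forall>B. unital_cstar_algebra B \<longrightarrow> G \<subseteq> B \<longrightarrow> X \<in> B)" for X
    by (auto simp: cstar_generated_def)
  have "cstar_generated G \<subseteq> bounded_ops"
    using assms unital_cstar_algebra_bounded_ops by (auto simp: cstar_generated_def)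
  moreover have "closed (cstar_generated G)"
    unfolding cstar_generated_def by (rule closed_Inter) (auto dest: unital_cstar_algebraD(7))
  moreover have "id_blinfun \<in> cstar_generated G"
    unfolding cstar_generated_def by (auto dest: unital_cstar_algebraD(2))
  moreover have "X + Y \<in> cstar_generated G \<and> X o\<^sub>L Y \<in> cstar_generated G"
    if "X \<in> cstar_generated G" "Y \<in> cstar_generated G" for X Y
    using that unfolding iff by (simp add: unital_cstar_algebraD)
  moreover have "scaleC_op c X \<in> cstar_generated G \<and> adj X \<in> cstar_generated G"
    if "X \<in> cstar_generated G" for X c
    using that unfolding iff by (simp add: unital_cstar_algebraD)
  ultimately show ?thesis
    unfolding unital_cstar_algebra_def by (intro conjI ballI allI) simp_all
qed

lemma cstar_generated_minimal:
  "unital_cstar_algebra B \<Longrightarrow> G \<subseteq> B \<Longrightarrow> cstar_generated G \<subseteq> B"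
  by (auto simp: cstar_generated_def)

lemma subset_cstar_generated: "G \<subseteq> cstar_generated G"
  by (auto simp: cstar_generated_def)

lemma unital_cstar_algebra_closure:
  assumes bo: "D \<subseteq> bounded_ops" and one: "id_blinfun \<in> D"
    and add: "\<And>X Y. X \<in> D \<Longrightarrow> Y \<in> D \<Longrightarrow> X + Y \<in> D"
    and mult: "\<And>X Y. X \<in> D \<Longrightarrow> Y \<in> D \<Longrightarrow> X o\<^sub>L Y \<in> D"
    and scale: "\<And>X c. X \<in> D \<Longrightarrow> scaleC_op c X \<in> D"
    and adj: "\<And>X. X \<in> D \<Longrightarrow> adj X \<in> D"
  shows "unital_cstar_algebra (closure D)"
  unfolding unital_cstar_algebra_def
proof (intro conjI ballI allI)
  show cb: "closure D \<subseteq> bounded_ops" by (rule closure_minimal [OF bo closed_bounded_ops])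
  show "id_blinfun \<in> closure D" using one closure_subset by blast
  have limI: "S \<in> closure D" if "\<And>n. s n \<in> D" "s \<longlonglongrightarrow> S" for s S
    using that unfolding closure_sequential by blast
  fix X assume X: "X \<in> closure D"
  then obtain x where x: "\<And>n. x n \<in> D" "x \<longlonglongrightarrow> X" unfolding closure_sequential by blast
  show "scaleC_op c X \<in> closure D" for c
    by (rule limI [OF scale [OF x(1)] bounded_linear.tendsto [OF bounded_linear_scaleC_op x(2)]])
  \<comment> \<open>Continuity of the adjoint comes from \<open>norm_adj_le\<close> applied to the
    differences \<open>x n - X\<close>, all of which lie in \<open>bounded_ops\<close>.\<close>
  have "(\<lambda>n. adj (x n)) \<longlonglongrightarrow> adj X"
  proof (rule LIMSEQ_I)
    fix e :: real assume "0 < e"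
    then obtain N where N: "\<And>n. n \<ge> N \<Longrightarrow> norm (x n - X) < e"
      using LIMSEQ_D [OF x(2)] by blast
    have "norm (adj (x n) - adj X) \<le> norm (x n - X)" for n
      using norm_adj_le [OF bounded_ops_diff [OF subsetD [OF bo x(1)] subsetD [OF cb X]]]
      unfolding adj_diff [OF subsetD [OF bo x(1)] subsetD [OF cb X]] .
    then show "\<exists>N. \<forall>n\<ge>N. norm (adj (x n) - adj X) < e" using N by (meson le_less_trans)
  qed
  then show "adj X \<in> closure D" by (rule limI [OF adj [OF x(1)]])
  fix Y assume Y: "Y \<in> closure D"
  then obtain y where y: "\<And>n. y n \<in> D" "y \<longlonglongrightarrow> Y" unfolding closure_sequential by blast
  show "X + Y \<in> closure D"
    by (rule limI [OF add [OF x(1) y(1)] tendsto_add [OF x(2) y(2)]])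
  show "X o\<^sub>L Y \<in> closure D"
    by (rule limI [OF mult [OF x(1) y(1)]
        bounded_bilinear.tendsto [OF bounded_bilinear_blinfun_compose x(2) y(2)]])
qed simp

section \<open>Compact operators\<close>

text \<open>Completeness lets compactness of a closed set be tested by total boundedness, which is
  how limits of compact operators are treated in \<open>closed_compact_ops\<close>.\<close>

instance ell2 :: (type) banach
proof
  fix X :: "nat \<Rightarrow> 'a ell2" assume X: "Cauchy X"
  have "Cauchy (\<lambda>n. coord (X n) i)" for i
  proof (rule CauchyI)
    fix e :: real assume "0 < e"
    then obtain M where "\<And>m n. m \<ge> M \<Longrightarrow> n \<ge> M \<Longrightarrow> norm (X m - X n) < e"
      using CauchyD [OF X] by blast
    then show "\<exists>M. \<forall>m\<ge>M. \<forall>n\<ge>M. norm (coord (X m) i - coord (X n) i) < e"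
      using cmod_coord_le_norm [of "X _ - X _" i] by (metis coord_diff le_less_trans)
  qed
  then have "\<exists>l. (\<lambda>n. coord (X n) i) \<longlonglongrightarrow> l" for i
    by (simp add: Cauchy_convergent_iff convergent_def)
  then obtain x where x: "\<And>i. (\<lambda>n. coord (X n) i) \<longlonglongrightarrow> x i" by metis
  \<comment> \<open>The Cauchy bound is restricted to finitely many coordinates, where the limit in
    \<open>n\<close> can be taken termwise. The result is uniform in \<open>F\<close>, hence a bound
    for the full norm.\<close>
  have L: "L2_set (\<lambda>i. cmod (coord (X m) i - x i)) F \<le> e"
    if M: "\<And>m n. m \<ge> M \<Longrightarrow> n \<ge> M \<Longrightarrow> norm (X m - X n) < e" and m: "m \<ge> M" and F: "finite F"
    for M m e F
  proof (rule LIMSEQ_le_const2)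
    show "(\<lambda>n. L2_set (\<lambda>i. cmod (coord (X m) i - coord (X n) i)) F)
        \<longlonglongrightarrow> L2_set (\<lambda>i. cmod (coord (X m) i - x i)) F"
      unfolding L2_set_def by (intro tendsto_intros x)
    show "\<exists>N. \<forall>n\<ge>N. L2_set (\<lambda>i. cmod (coord (X m) i - coord (X n) i)) F \<le> e"
      using L2_set_le_norm [OF F, of "X m - X _"] M [OF m]
      by (intro exI [of _ M]) (metis (no_types, lifting) L2_set_cong coord_diff le_less_trans less_imp_le)
  qed
  obtain N where N: "\<And>m n. m \<ge> N \<Longrightarrow> n \<ge> N \<Longrightarrow> norm (X m - X n) < 1"
    using CauchyD [OF X zero_less_one] by blast
  \<comment> \<open>The coordinatewise limit \<open>x\<close> is not yet known to be
    square-summable, but its difference from the fixed vector \<open>X N\<close> is, by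
    \<open>L\<close>. The limit vector is therefore obtained as \<open>X N - d\<close>.\<close>
  define d where "d = Abs_ell2 (\<lambda>i. coord (X N) i - x i)"
  have d: "coord d i = coord (X N) i - x i" for i
    unfolding d_def by (subst Abs_ell2_inverse) (use sq_summableI(1) [OF L [OF N order_refl]] in auto)
  have "X \<longlonglongrightarrow> X N - d"
  proof (rule LIMSEQ_I)
    fix e :: real assume "0 < e"
    then obtain M where M: "\<And>m n. m \<ge> M \<Longrightarrow> n \<ge> M \<Longrightarrow> norm (X m - X n) < e / 2"
      using CauchyD [OF X, of "e / 2"] by auto
    have "norm (X m - (X N - d)) \<le> e / 2" if "m \<ge> M" for m
      by (rule norm_leI) (use L [OF M that] in \<open>simp add: d\<close>)
    then show "\<exists>M. \<forall>m\<ge>M. norm (X m - (X N - d)) < e"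
      using \<open>0 < e\<close> by (intro exI [of _ M]) force
  qed
  then show "convergent X" by (auto simp: convergent_def)
qed

lemma compact_opsI:
  assumes "T \<in> bounded_ops" "compact K" "blinfun_apply T ` cball 0 1 \<subseteq> K"
  shows "T \<in> compact_ops"
proof -
  have "closure (blinfun_apply T ` cball 0 1) \<subseteq> K"
    by (rule closure_minimal [OF assms(3) compact_imp_closed [OF assms(2)]])
  then have "compact (closure (blinfun_apply T ` cball 0 1))"
    using compact_Int_closed [OF assms(2) closed_closure] by (metis inf.absorb2)
  then show ?thesis using assms(1) by (simp add: compact_ops_def)
qed

lemma compact_opsD:
  assumes "T \<in> compact_ops"
  shows "T \<in> bounded_ops" "compact (closure (blinfun_apply T ` cball 0 1))"
    and "norm x \<le> 1 \<Longrightarrow> blinfun_apply T x \<in> closure (blinfun_apply T ` cball 0 1)"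
  using assms closure_subset [of "blinfun_apply T ` cball 0 1"] by (auto simp: compact_ops_def)

lemma compact_ops_add:
  assumes "S \<in> compact_ops" "T \<in> compact_ops"
  shows "S + T \<in> compact_ops"
  by (rule compact_opsI [OF _ compact_sums [OF compact_opsD(2) [OF assms(1)] compact_opsD(2) [OF assms(2)]]])
    (auto simp: blinfun.add_left intro!: bounded_ops_add compact_opsD(1) [OF assms(1)]
      compact_opsD(1) [OF assms(2)] exI conjI compact_opsD(3) [OF assms(1)] compact_opsD(3) [OF assms(2)] refl)

lemma compact_ops_scaleC_op:
  assumes "T \<in> compact_ops"
  shows "scaleC_op c T \<in> compact_ops"
  by (rule compact_opsI [OF bounded_ops_scaleC_op compact_continuous_image
        [OF linear_continuous_on [OF bounded_linear_scaleC [of c]] compact_opsD(2) [OF assms]]])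
    (auto intro!: imageI compact_opsD(1,3) [OF assms])

text \<open>A rank-one operator maps the unit ball into a closed disc of the complex line through
  one basis vector.\<close>

lemma matrix_unit_compact_ops: "matrix_unit j k \<in> compact_ops"
proof (rule compact_opsI [OF matrix_unit_bounded_ops])
  show "compact ((\<lambda>c. c *\<^sub>C basis j) ` cball 0 1)"
    by (intro compact_continuous_image linear_continuous_on bounded_linear_scaleC_left compact_cball)
  show "blinfun_apply (matrix_unit j k) ` cball 0 1 \<subseteq> (\<lambda>c. c *\<^sub>C basis j) ` cball 0 1"
    by (auto intro!: imageI order_trans [OF cmod_coord_le_norm])
qed

text \<open>A finite net for the image of the unit ball under a nearby \<open>T n\<close> is, with a
  larger radius, a finite net for the image under \<open>S\<close>.\<close>

lemma closed_compact_ops: "closed (compact_ops :: 'a op set)"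
  unfolding closed_sequential_limits
proof (intro allI impI, elim conjE)
  fix T :: "nat \<Rightarrow> 'a op" and S
  assume T: "\<forall>n. T n \<in> compact_ops" and lim: "T \<longlonglongrightarrow> S"
  have "S \<in> bounded_ops"
    using closed_sequentially [OF closed_bounded_ops _ lim] T by (simp add: compact_opsD(1))
  moreover have "compact (closure (blinfun_apply S ` cball 0 1))"
    unfolding compact_eq_totally_bounded
  proof (intro conjI allI impI)
    fix e :: real assume "0 < e"
    then obtain n where n: "norm (T n - S) < e / 4"
      using LIMSEQ_D [OF lim, of "e / 4"] by auto
    obtain k where k: "finite k" "closure (blinfun_apply (T n) ` cball 0 1) \<subseteq> (\<Union>x\<in>k. ball x (e / 4))"
      using compact_opsD(2) [OF T [rule_format, of n]] \<open>0 < e\<close>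
      unfolding compact_eq_totally_bounded by (meson divide_pos_pos zero_less_numeral)
    \<comment> \<open>Closed balls of radius \<open>e / 2\<close> are used because a finite union of
      them is closed and so contains the closure of the image as well; they are enlarged to open
      balls of radius \<open>e\<close> afterwards.\<close>
    have "blinfun_apply S ` cball 0 1 \<subseteq> (\<Union>x\<in>k. cball x (e / 2))"
    proof (rule image_subsetI)
      fix v :: "'a ell2" assume "v \<in> cball 0 1"
      then have v: "norm v \<le> 1" by simp
      have "blinfun_apply (T n) v \<in> (\<Union>x\<in>k. ball x (e / 4))"
        using k(2) compact_opsD(3) [OF T [rule_format, of n] v] by blast
      then obtain x where x: "x \<in> k" "dist x (blinfun_apply (T n) v) < e / 4" by auto
      have "dist (blinfun_apply (T n) v) (blinfun_apply S v) \<le> norm (T n - S) * norm v"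
        unfolding dist_norm blinfun.diff_left [symmetric] by (rule norm_blinfun)
      also have "\<dots> \<le> norm (T n - S)" using v by (simp add: mult_left_le)
      finally have "dist x (blinfun_apply S v) \<le> e / 2"
        using x(2) n dist_triangle [of x "blinfun_apply S v" "blinfun_apply (T n) v"] by linarith
      then show "blinfun_apply S v \<in> (\<Union>x\<in>k. cball x (e / 2))" using x(1) by auto
    qed
    then have "closure (blinfun_apply S ` cball 0 1) \<subseteq> (\<Union>x\<in>k. cball x (e / 2))"
      by (rule closure_minimal) (intro closed_UN k(1) ballI closed_cball)
    also have "\<dots> \<subseteq> (\<Union>x\<in>k. ball x e)" using \<open>0 < e\<close> by fastforce
    finally show "\<exists>k. finite k \<and> closure (blinfun_apply S ` cball 0 1) \<subseteq> (\<Union>x\<in>k. ball x e)"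
      using k(1) by blast
  qed (simp add: complete_eq_closed)
  ultimately show "S \<in> compact_ops" by (simp add: compact_ops_def)
qed

lemma matrix_unit_compose:
  "matrix_unit i j o\<^sub>L matrix_unit k l = (if j = k then matrix_unit i l else 0)"
  by (rule blinfun_eqI, rule ell2_eqI) auto

section \<open>The Boolean algebra and its shift\<close>

lemma boolean_cstar_unital: "unital_cstar_algebra boolean_cstar"
  unfolding boolean_cstar_def
  by (rule unital_cstar_algebra_generated)
    (auto simp: annihilation_def matrix_unit_bounded_ops)

lemmas boolean_cstar_closed = unital_cstar_algebraD [OF boolean_cstar_unital]

lemma boolean_cstar_bounded: "X \<in> boolean_cstar \<Longrightarrow> X \<in> bounded_ops"
  using boolean_cstar_closed(1) by blast

text \<open>Every matrix unit is an annihilator, the adjoint of one, or a product of the two: an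
  annihilator times its adjoint is the vacuum projection, and an adjoint times an annihilator gives
  the units between particle vectors.\<close>

lemma matrix_unit_boolean: "matrix_unit j k \<in> boolean_cstar"
proof -
  have a: "matrix_unit None (Some i) \<in> boolean_cstar" for i
    using subset_cstar_generated [of "range annihilation"]
    by (auto simp: boolean_cstar_def annihilation_def)
  have b: "matrix_unit (Some i) None \<in> boolean_cstar" for i
    using boolean_cstar_closed(6) [OF a [of i]] by (simp add: adj_matrix_unit)
  have c: "matrix_unit None None \<in> boolean_cstar"
    using boolean_cstar_closed(4) [OF a [of 0] b [of 0]] by (simp add: matrix_unit_compose)
  have "matrix_unit (Some i) (Some l) \<in> boolean_cstar" for i l
    using boolean_cstar_closed(4) [OF b a] by (simp add: matrix_unit_compose)
  with a b c show ?thesis by (cases j; cases k) auto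
qed

lemma scaleC_op_compose:
  assumes "X \<in> bounded_ops"
  shows "scaleC_op c X o\<^sub>L scaleC_op d Y = scaleC_op (c * d) (X o\<^sub>L Y)"
  by (rule blinfun_eqI) (simp add: bounded_ops_scaleC [OF assms] scaleC_distribs)

lemma subspace_bounded_ops: "subspace bounded_ops"
  unfolding subspace_def
  by (auto simp: scaleR_eq_scaleC_op bounded_ops_add bounded_ops_scaleC_op)
    (auto simp: bounded_ops_def intro!: ell2_eqI)

lemma subspace_boolean_cstar: "subspace boolean_cstar"
  unfolding subspace_def
  using boolean_cstar_closed(5) [OF boolean_cstar_closed(2), of 0]
  by (auto simp: scaleR_eq_scaleC_op boolean_cstar_closed)

text \<open>An induction principle for the algebra: a property preserved by real-linear combinations
  and norm limits has to be checked only on scalars and multiples of matrix units. It holds because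
  these elements span a *-algebra, products of units being units or zero, whose closure contains the
  generators.\<close>

lemma boolean_cstar_subset_closed_subspace:
  assumes sub: "subspace S" and cl: "closed S"
    and id: "\<And>c. scaleC_op c id_blinfun \<in> S"
    and unit: "\<And>c j k. scaleC_op c (matrix_unit j k) \<in> S"
  shows "boolean_cstar \<subseteq> S"
proof -
  define U :: "int option op set" where "U = insert id_blinfun {matrix_unit j k |j k. True}"
  \<comment> \<open>Complex multiples are built into the generators, so that the real
    \<open>span\<close> of \<open>G\<close> is a complex subspace.\<close>
  define G where "G = {scaleC_op c X |c X. X \<in> U}"
  have UE: "matrix_unit j k \<in> U" for j k unfolding U_def by blast
  have U: "X \<in> bounded_ops" "adj X \<in> U" if "X \<in> U" for X
    using that unfolding U_def
    by (auto simp: bounded_ops_id matrix_unit_bounded_ops adj_id) (metis adj_matrix_unit)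
  have UU: "X o\<^sub>L Y \<in> U \<or> X o\<^sub>L Y = 0" if "X \<in> U" "Y \<in> U" for X Y
  proof -
    have unit: "id_blinfun o\<^sub>L Z = Z" "Z o\<^sub>L id_blinfun = Z" for Z :: "int option op"
      by (rule blinfun_eqI, simp)+
    have "matrix_unit i j o\<^sub>L matrix_unit k l \<in> U \<or> matrix_unit i j o\<^sub>L matrix_unit k l = 0"
      for i j k l :: "int option"
      unfolding matrix_unit_compose by (cases "j = k") (simp_all add: UE)
    moreover have "X = id_blinfun \<or> (\<exists>j k. X = matrix_unit j k)"
      "Y = id_blinfun \<or> (\<exists>j k. Y = matrix_unit j k)"
      using that unfolding U_def by blast+
    ultimately show ?thesis using that by (elim disjE exE) (simp_all add: unit)
  qed
  have GI: "scaleC_op c X \<in> span G" if "X \<in> U" for c X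
    using that by (auto simp: G_def intro!: span_base)
  have bo: "span G \<subseteq> bounded_ops"
    by (rule span_minimal [OF _ subspace_bounded_ops])
      (auto simp: G_def bounded_ops_scaleC_op U(1))
  have lin: "L X \<in> span G" if X: "X \<in> span G" and L: "linear L" and G: "\<And>Y. Y \<in> G \<Longrightarrow> L Y \<in> span G"
    for L :: "int option op \<Rightarrow> int option op" and X
  proof -
    have "L ` span G \<subseteq> span G"
      unfolding linear_span_image [OF L, symmetric] by (rule span_minimal) (use G in auto)
    then show ?thesis using X by blast
  qed
  have GG: "X o\<^sub>L Y \<in> span G" if XY: "X \<in> G" "Y \<in> G" for X Y
  proof -
    obtain c d P Q where PQ: "P \<in> U" "Q \<in> U" and X: "X = scaleC_op c P" and Y: "Y = scaleC_op d Q"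
      using XY unfolding G_def by blast
    have "X o\<^sub>L Y = scaleC_op (c * d) (P o\<^sub>L Q)"
      unfolding X Y by (rule scaleC_op_compose [OF U(1) [OF PQ(1)]])
    then show ?thesis
      using UU [OF PQ]
      by (auto simp: GI span_zero)
  qed
  have "unital_cstar_algebra (closure (span G))"
  proof (rule unital_cstar_algebra_closure [OF bo])
    show "id_blinfun \<in> span G"
      using GI [of id_blinfun 1] by (simp add: U_def scaleC_op_one)
    fix X assume X: "X \<in> span G"
    show "scaleC_op c X \<in> span G" for c
    proof (rule lin [OF X bounded_linear.linear [OF bounded_linear_scaleC_op]])
      show "scaleC_op c Y \<in> span G" if "Y \<in> G" for Y
        using that GI by (auto simp: G_def scaleC_op_scaleC_op)
    qed
    \<comment> \<open>Additivity of \<open>adj\<close> is available on \<open>bounded_ops\<close>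
      only, so \<open>lin\<close> cannot be applied to it. The subspace of candidates carries
      membership in \<open>bounded_ops\<close> along instead.\<close>
    have "span G \<subseteq> {X \<in> bounded_ops. adj X \<in> span G}"
    proof (rule span_minimal)
      show "subspace {X \<in> bounded_ops. adj X \<in> span G}"
        using subspace_bounded_ops unfolding subspace_def
        by (auto simp: adj_zero adj_add adj_scaleR span_zero span_add span_scale)
    next
      show "G \<subseteq> {X \<in> bounded_ops. adj X \<in> span G}"
        using U GI by (auto simp: G_def bounded_ops_scaleC_op adj_scaleC_op)
    qed
    then show "adj X \<in> span G" using X by blast
    fix Y assume Y: "Y \<in> span G"
    show "X + Y \<in> span G" by (rule span_add [OF X Y])
    \<comment> \<open>Bilinearity reduces first \<open>Y\<close> and then \<open>X\<close> to
      elements of \<open>G\<close>, where \<open>GG\<close> applies.\<close>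
    show "X o\<^sub>L Y \<in> span G"
    proof (rule lin [OF Y bounded_linear.linear])
      show "bounded_linear ((o\<^sub>L) X)"
        by (rule bounded_bilinear.bounded_linear_right [OF bounded_bilinear_blinfun_compose])
      show "X o\<^sub>L Z \<in> span G" if "Z \<in> G" for Z
        by (rule lin [OF X bounded_linear.linear, where L = "\<lambda>X. X o\<^sub>L Z"])
          (auto intro!: GG that
            bounded_bilinear.bounded_linear_left [OF bounded_bilinear_blinfun_compose])
    qed
  qed
  moreover have "range annihilation \<subseteq> closure (span G)"
    using GI [of "matrix_unit _ _" 1] closure_subset
    by (fastforce simp: annihilation_def scaleC_op_one U_def)
  ultimately have "boolean_cstar \<subseteq> closure (span G)"
    unfolding boolean_cstar_def by (rule cstar_generated_minimal)
  also have "\<dots> \<subseteq> S"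
    by (intro closure_minimal span_minimal sub cl) (auto simp: G_def U_def id unit)
  finally show ?thesis .
qed

section \<open>The shift as conjugation by translations\<close>

definition shift_by :: "int \<Rightarrow> int option op \<Rightarrow> int option op"
  where "shift_by d X = translation d o\<^sub>L X o\<^sub>L translation (- d)"

text \<open>Replacing the adjoint of the translation by the opposite translation places the shift in
  a one-parameter group, which also contains its iterates and its inverse.\<close>

lemma shift_eq_shift_by: "shift = shift_by 1"
  by (simp add: fun_eq_iff shift_def shift_by_def adj_translation)

lemma translate_translate: "translate d (translate e x) = translate (d + e) x"
  by (rule ell2_eqI) (simp add: option.map_comp comp_def diff_diff_eq)

lemma translate_0: "translate 0 x = x"
  by (rule ell2_eqI) (simp add: option.map_ident)

lemma shift_by_apply: "blinfun_apply (shift_by d X) x = translate d (blinfun_apply X (translate (- d) x))"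
  by (simp add: shift_by_def)

lemma shift_by_shift_by: "shift_by d (shift_by e X) = shift_by (d + e) X"
  by (rule blinfun_eqI) (simp add: shift_by_apply translate_translate add.commute)

lemma shift_by_0: "shift_by 0 X = X"
  by (rule blinfun_eqI) (simp add: shift_by_apply translate_0)

lemma shift_funpow: "(shift ^^ n) X = shift_by (int n) X"
  by (induction n) (simp_all add: shift_by_0 shift_eq_shift_by shift_by_shift_by)

lemma translate_add: "translate d (x + y) = translate d x + translate d y"
  by (rule ell2_eqI) simp

lemma translate_scaleC: "translate d (c *\<^sub>C x) = c *\<^sub>C translate d x"
  by (rule ell2_eqI) simp

lemma shift_by_add: "shift_by d (X + Y) = shift_by d X + shift_by d Y"
  by (rule blinfun_eqI) (simp add: shift_by_apply blinfun.add_left translate_add)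

lemma shift_by_scaleC_op: "shift_by d (scaleC_op c X) = scaleC_op c (shift_by d X)"
  by (rule blinfun_eqI) (simp add: shift_by_apply translate_scaleC)

lemma shift_by_compose: "shift_by d (X o\<^sub>L Y) = shift_by d X o\<^sub>L shift_by d Y"
  by (rule blinfun_eqI) (simp add: shift_by_apply translate_translate translate_0)

lemma shift_by_id: "shift_by d id_blinfun = id_blinfun"
  by (rule blinfun_eqI) (simp add: shift_by_apply translate_translate translate_0)

lemma shift_by_adj:
  assumes "X \<in> bounded_ops"
  shows "shift_by d (adj X) = adj (shift_by d X)"
  by (rule blinfun_eqI)
    (simp add: shift_by_def adj_compose adj_translation bounded_ops_compose
      translation_bounded_ops assms)

lemma norm_shift_by_le: "norm (shift_by d X) \<le> norm X"
proof (rule norm_blinfun_bound)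
  show "norm (blinfun_apply (shift_by d X) x) \<le> norm X * norm x" for x
    using norm_blinfun [of X "translate (- d) x"] by (simp add: shift_by_apply)
qed simp

lemma bounded_linear_shift_by: "bounded_linear (shift_by d)"
  by (rule bounded_linear_intro [where K = 1])
    (simp_all add: shift_by_add scaleR_eq_scaleC_op shift_by_scaleC_op norm_shift_by_le)

lemma translate_basis: "translate d (basis k) = basis (map_option (\<lambda>i. i + d) k)"
  using translation_basis [of d] by (cases k) auto

lemma coord_shift_by:
  "coord (blinfun_apply (shift_by d X) (basis k)) j =
    coord (blinfun_apply X (basis (map_option (\<lambda>i. i - d) k))) (map_option (\<lambda>i. i - d) j)"
  by (simp add: shift_by_apply translate_basis)

lemma shift_by_matrix_unit:
  "shift_by d (matrix_unit j k) = matrix_unit (map_option (\<lambda>i. i + d) j) (map_option (\<lambda>i. i + d) k)"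
  by (rule blinfun_eqI) (simp add: shift_by_apply translate_scaleC translate_basis)

text \<open>The preimage of the algebra under a shift is a closed subspace, and a shift fixes the
  identity and permutes the matrix units.\<close>

lemma shift_by_boolean:
  assumes "X \<in> boolean_cstar"
  shows "shift_by d X \<in> boolean_cstar"
proof -
  have "boolean_cstar \<subseteq> shift_by d -` boolean_cstar"
  proof (rule boolean_cstar_subset_closed_subspace)
    show "subspace (shift_by d -` boolean_cstar)"
      by (rule linear_subspace_vimage [OF bounded_linear.linear [OF bounded_linear_shift_by]
            subspace_boolean_cstar])
    show "closed (shift_by d -` boolean_cstar)"
      by (rule closed_vimage [OF boolean_cstar_closed(7)])
        (rule linear_continuous_on [OF bounded_linear_shift_by])
  qed (auto simp: shift_by_scaleC_op shift_by_id shift_by_matrix_unit matrix_unit_boolean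
      boolean_cstar_closed)
  with assms show ?thesis by blast
qed

lemma star_automorphism_shift: "star_automorphism boolean_cstar shift"
  unfolding star_automorphism_def complex_linear_on_def shift_eq_shift_by
proof (intro conjI ballI allI)
  show "bij_betw (shift_by 1) boolean_cstar boolean_cstar"
    by (rule bij_betw_byWitness [where f' = "shift_by (- 1)"])
      (auto simp: shift_by_shift_by shift_by_0 shift_by_boolean)
qed (simp_all add: shift_by_add shift_by_scaleC_op shift_by_compose shift_by_adj boolean_cstar_bounded)

section \<open>Diagonal limits and the splitting into a compact and a scalar part\<close>

definition diag_entry :: "int option op \<Rightarrow> nat \<Rightarrow> complex"
  where "diag_entry X n = coord (blinfun_apply X (basis (Some (int n)))) (Some (int n))"

lemma cmod_matrix_entry_le: "cmod (coord (blinfun_apply X (basis k)) j) \<le> norm X"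
  using order_trans [OF cmod_coord_le_norm norm_blinfun [of X "basis k"]] by simp

lemma diag_entry_add: "diag_entry (X + Y) n = diag_entry X n + diag_entry Y n"
  and diag_entry_diff: "diag_entry (X - Y) n = diag_entry X n - diag_entry Y n"
  and diag_entry_scaleC_op: "diag_entry (scaleC_op c X) n = c * diag_entry X n"
  and cmod_diag_entry_le: "cmod (diag_entry X n) \<le> norm X"
  by (simp_all add: diag_entry_def blinfun.add_left blinfun.diff_left cmod_matrix_entry_le)

lemma diag_entry_matrix_unit_tendsto: "diag_entry (matrix_unit j k) \<longlonglongrightarrow> 0"
proof (rule tendsto_eventually, rule eventually_sequentiallyI)
  show "diag_entry (matrix_unit j k) n = 0"
    \<comment> \<open>The threshold depends on the row index alone: past it
      \<open>Some (int n)\<close> differs from \<open>j\<close>, whatever \<open>k\<close> is. A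
      negative index is sent to \<open>0\<close> by \<open>nat\<close>, and \<open>Suc\<close>
      covers it.\<close>
    if "Suc (case j of None \<Rightarrow> 0 | Some i \<Rightarrow> nat i) \<le> n" for n
    using that by (auto simp: diag_entry_def split: option.splits)
qed

text \<open>The diagonal limit and the compactness of the remainder are proved together for the same
  \<open>b\<close>. This ties the scalar in the definition of \<open>boolean_expectation\<close> to
  a quantity that can be computed from matrix entries.\<close>

lemma boolean_cstar_decomposition:
  assumes "X \<in> boolean_cstar"
  shows "\<exists>b. diag_entry X \<longlonglongrightarrow> b \<and> X - scaleC_op b id_blinfun \<in> compact_ops"
proof -
  define S where "S = {X. \<exists>b. diag_entry X \<longlonglongrightarrow> b \<and> X - scaleC_op b id_blinfun \<in> compact_ops}"
  have compact_0: "0 \<in> compact_ops"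
    using compact_ops_scaleC_op [OF matrix_unit_compact_ops, of 0] by simp
  have scale: "scaleC_op c X \<in> S" if X: "X \<in> S" for c X
  proof -
    obtain b where b: "diag_entry X \<longlonglongrightarrow> b" "X - scaleC_op b id_blinfun \<in> compact_ops"
      using X by (auto simp: S_def)
    have "scaleC_op c X - scaleC_op (c * b) id_blinfun = scaleC_op c (X - scaleC_op b id_blinfun)"
      by (rule blinfun_eqI) (simp add: blinfun.diff_left scaleC_distribs)
    with b show ?thesis
      unfolding S_def
      by (auto intro!: exI [of _ "c * b"] tendsto_mult_left compact_ops_scaleC_op
          simp: diag_entry_scaleC_op [abs_def])
  qed
  have "boolean_cstar \<subseteq> S"
  proof (rule boolean_cstar_subset_closed_subspace)
    show "subspace S"
      unfolding subspace_def scaleR_eq_scaleC_op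
    proof (intro conjI ballI allI scale)
      show "0 \<in> S"
        using compact_0 by (auto simp: S_def diag_entry_def [abs_def] intro!: exI [of _ 0])
      fix X Y assume "X \<in> S" "Y \<in> S"
      then obtain b c where b: "diag_entry X \<longlonglongrightarrow> b" "X - scaleC_op b id_blinfun \<in> compact_ops"
        and c: "diag_entry Y \<longlonglongrightarrow> c" "Y - scaleC_op c id_blinfun \<in> compact_ops"
        unfolding S_def by blast
      have "X + Y - scaleC_op (b + c) id_blinfun = (X - scaleC_op b id_blinfun) + (Y - scaleC_op c id_blinfun)"
        by (simp add: scaleC_op_add_left)
      then have "X + Y - scaleC_op (b + c) id_blinfun \<in> compact_ops"
        using compact_ops_add [OF b(2) c(2)] by (simp only:)
      moreover have "diag_entry (X + Y) \<longlonglongrightarrow> b + c"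
        unfolding diag_entry_add [abs_def] by (rule tendsto_add [OF b(1) c(1)])
      ultimately show "X + Y \<in> S" unfolding S_def by blast
    qed
    show "closed S"
      unfolding closed_sequential_limits
    proof (intro allI impI, elim conjE)
      fix T :: "nat \<Rightarrow> int option op" and X
      assume "\<forall>m. T m \<in> S" and lim: "T \<longlonglongrightarrow> X"
      then obtain b where b: "\<And>m. diag_entry (T m) \<longlonglongrightarrow> b m"
        and c: "\<And>m. T m - scaleC_op (b m) id_blinfun \<in> compact_ops"
        unfolding S_def mem_Collect_eq by metis
      \<comment> \<open>Diagonal entries are contractive in the operator, and so are their limits;
        the scalar parts of a norm-convergent sequence are therefore Cauchy.\<close>
      have bd: "norm (b m - b n) \<le> norm (T m - T n)" for m n
      proof (rule Lim_norm_ubound [OF _ tendsto_diff [OF b b]])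
        show "\<forall>\<^sub>F i in sequentially. norm (diag_entry (T m) i - diag_entry (T n) i) \<le> norm (T m - T n)"
          unfolding diag_entry_diff [symmetric] by (simp add: cmod_diag_entry_le)
      qed simp
      have "Cauchy b"
      proof (rule CauchyI)
        fix e :: real assume "0 < e"
        then obtain M where "\<And>m n. m \<ge> M \<Longrightarrow> n \<ge> M \<Longrightarrow> norm (T m - T n) < e"
          using CauchyD [OF LIMSEQ_imp_Cauchy [OF lim]] by blast
        then show "\<exists>M. \<forall>m\<ge>M. \<forall>n\<ge>M. norm (b m - b n) < e"
          using bd by (meson le_less_trans)
      qed
      then obtain l where l: "b \<longlonglongrightarrow> l"
        by (auto simp: Cauchy_convergent_iff convergent_def)
      \<comment> \<open>The approximation is uniform along the diagonal, which permits exchanging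
        the limit in \<open>m\<close> with the limit along the diagonal.\<close>
      have unif: "uniform_limit UNIV (\<lambda>m. diag_entry (T m)) (diag_entry X) sequentially"
      proof (rule uniform_limitI)
        fix e :: real assume "0 < e"
        then have "\<forall>\<^sub>F m in sequentially. dist (T m) X < e" using lim by (rule tendstoD [rotated])
        then show "\<forall>\<^sub>F m in sequentially. \<forall>n\<in>UNIV. dist (diag_entry (T m) n) (diag_entry X n) < e"
          unfolding dist_norm diag_entry_diff [symmetric]
          by (rule eventually_mono) (auto intro: le_less_trans [OF cmod_diag_entry_le])
      qed
      have "diag_entry X \<longlonglongrightarrow> l"
        by (rule swap_uniform_limit' [OF _ l unif]) (simp_all add: b)
      moreover have "(\<lambda>m. T m - scaleC_op (b m) id_blinfun) \<longlonglongrightarrow> X - scaleC_op l id_blinfun"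
        by (intro tendsto_diff lim bounded_linear.tendsto [OF bounded_linear_scaleC_op_left l])
      then have "X - scaleC_op l id_blinfun \<in> compact_ops"
        by (rule closed_sequentially [OF closed_compact_ops, rotated]) (rule c)
      ultimately show "X \<in> S" by (auto simp: S_def)
    qed
    have "id_blinfun \<in> S"
      by (auto simp: S_def diag_entry_def [abs_def] scaleC_op_one compact_0 intro!: exI [of _ 1])
    then show "scaleC_op c id_blinfun \<in> S" for c by (rule scale)
    have "matrix_unit j k \<in> S" for j k
      unfolding S_def mem_Collect_eq
      by (intro exI [of _ 0]) (simp add: matrix_unit_compact_ops diag_entry_matrix_unit_tendsto)
    then show "scaleC_op c (matrix_unit j k) \<in> S" for c j k by (rule scale)
  qed
  with assms show ?thesis by (auto simp: S_def)
qed

section \<open>The expectation\<close>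

text \<open>The diagonal operator with entry \<open>c\<close> at the vacuum and \<open>d\<close> at
  all other indices, that is \<open>c\<close> times the vacuum projection plus \<open>d\<close>
  times its complement. It is written in the shape in which the expectation is defined.\<close>

definition diag_op :: "complex \<Rightarrow> complex \<Rightarrow> int option op"
  where "diag_op c d = scaleC_op (c - d) vacuum_proj + scaleC_op d id_blinfun"

lemma coord_diag_op:
  "coord (blinfun_apply (diag_op c d) x) i = (if i = None then c else d) * coord x i"
  by (simp add: diag_op_def vacuum_proj_def blinfun.add_left algebra_simps)

lemma diag_op_eqI:
  assumes "\<And>x i. coord (blinfun_apply Y x) i = (if i = None then c else d) * coord x i"
  shows "Y = diag_op c d"
  by (rule blinfun_eqI, rule ell2_eqI) (simp only: assms coord_diag_op)

lemma diag_op_boolean: "diag_op c d \<in> boolean_cstar"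
  by (simp add: diag_op_def vacuum_proj_def boolean_cstar_closed matrix_unit_boolean)

lemma diag_op_add: "diag_op c d + diag_op c' d' = diag_op (c + c') (d + d')"
  by (rule diag_op_eqI) (simp add: blinfun.add_left coord_diag_op algebra_simps)

lemma diag_op_scaleC_op: "scaleC_op e (diag_op c d) = diag_op (e * c) (e * d)"
  by (rule diag_op_eqI) (simp add: coord_diag_op)

lemma diag_op_compose: "diag_op c d o\<^sub>L diag_op c' d' = diag_op (c * c') (d * d')"
  by (rule diag_op_eqI) (simp add: coord_diag_op)

lemma adj_diag_op: "adj (diag_op c d) = diag_op (cnj c) (cnj d)"
  by (rule adj_eqI) (auto simp: cinner.rep_eq coord_diag_op intro!: infsum_cong)

lemma shift_by_diag_op: "shift_by e (diag_op c d) = diag_op c d"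
  by (rule diag_op_eqI)
    (simp add: shift_by_apply coord_diag_op option.map_comp comp_def option.map_ident)

lemma norm_diag_op_le: "norm (diag_op c d) \<le> max (cmod c) (cmod d)"
  by (rule norm_blinfun_bound)
    (auto intro!: norm_le_coord mult_right_mono simp: coord_diag_op norm_mult le_max_iff_disj)

text \<open>The compact part is \<open>X\<close> minus \<open>b\<close> times the identity, so its
  vacuum entry is that of \<open>X\<close> minus \<open>b\<close>. This is exactly the coefficient
  \<open>c - d\<close> in \<open>diag_op_def\<close>.\<close>

lemma boolean_expectation_eq_diag_op:
  assumes X: "X \<in> boolean_cstar" and b: "diag_entry X \<longlonglongrightarrow> b"
  shows "boolean_expectation X = diag_op (coord (blinfun_apply X (basis None)) None) b"
proof -
  have A: "X - scaleC_op b id_blinfun \<in> compact_ops"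
    using boolean_cstar_decomposition [OF X] b LIMSEQ_unique by blast
  show ?thesis
    using boolean_expectation_eq [OF A, of b]
    by (simp add: diag_op_def blinfun.diff_left)
qed

lemma boolean_expectation_obtain:
  assumes "X \<in> boolean_cstar"
  obtains b where "diag_entry X \<longlonglongrightarrow> b" "cmod b \<le> norm X"
    "boolean_expectation X = diag_op (coord (blinfun_apply X (basis None)) None) b"
proof -
  obtain b where b: "diag_entry X \<longlonglongrightarrow> b" using boolean_cstar_decomposition [OF assms] by blast
  moreover have "cmod b \<le> norm X"
    by (rule Lim_norm_ubound [OF _ b]) (simp_all add: cmod_diag_entry_le)
  ultimately show ?thesis using that boolean_expectation_eq_diag_op [OF assms] by blast
qed

lemma boolean_expectation_boolean: "X \<in> boolean_cstar \<Longrightarrow> boolean_expectation X \<in> boolean_cstar"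
  by (metis boolean_expectation_obtain diag_op_boolean)

lemma boolean_expectation_shift_by_fixed:
  "X \<in> boolean_cstar \<Longrightarrow> shift_by d (boolean_expectation X) = boolean_expectation X"
  by (metis boolean_expectation_obtain shift_by_diag_op)

lemma norm_boolean_expectation_le:
  assumes "X \<in> boolean_cstar"
  shows "norm (boolean_expectation X) \<le> norm X"
proof -
  obtain b where b: "cmod b \<le> norm X"
    "boolean_expectation X = diag_op (coord (blinfun_apply X (basis None)) None) b"
    using boolean_expectation_obtain [OF assms] by blast
  show ?thesis
    unfolding b(2) by (rule order_trans [OF norm_diag_op_le]) (simp add: b(1) cmod_matrix_entry_le)
qed

lemma boolean_expectation_add:
  assumes X: "X \<in> boolean_cstar" and Y: "Y \<in> boolean_cstar"
  shows "boolean_expectation (X + Y) = boolean_expectation X + boolean_expectation Y"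
proof -
  obtain b c where b: "diag_entry X \<longlonglongrightarrow> b" and c: "diag_entry Y \<longlonglongrightarrow> c"
    using boolean_cstar_decomposition X Y by meson
  have "diag_entry (X + Y) \<longlonglongrightarrow> b + c"
    unfolding diag_entry_add [abs_def] by (rule tendsto_add [OF b c])
  then show ?thesis
    using X Y b c
    by (simp add: boolean_expectation_eq_diag_op boolean_cstar_closed diag_op_add blinfun.add_left)
qed

lemma boolean_expectation_scaleC_op:
  assumes X: "X \<in> boolean_cstar"
  shows "boolean_expectation (scaleC_op c X) = scaleC_op c (boolean_expectation X)"
proof -
  obtain b where b: "diag_entry X \<longlonglongrightarrow> b" using boolean_cstar_decomposition X by meson
  have "diag_entry (scaleC_op c X) \<longlonglongrightarrow> c * b"
    unfolding diag_entry_scaleC_op [abs_def] by (rule tendsto_mult_left [OF b])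
  then show ?thesis
    using X b by (simp add: boolean_expectation_eq_diag_op boolean_cstar_closed diag_op_scaleC_op)
qed

lemma boolean_expectation_shift:
  assumes X: "X \<in> boolean_cstar"
  shows "boolean_expectation (shift X) = boolean_expectation X"
proof -
  obtain b where b: "diag_entry X \<longlonglongrightarrow> b" using boolean_cstar_decomposition X by meson
  \<comment> \<open>The diagonal entry of the shifted operator at \<open>Suc n\<close> is that of
    \<open>X\<close> at \<open>n\<close>, so the two sequences have the same limit. The vacuum entry
    does not move.\<close>
  have "(\<lambda>n. diag_entry (shift_by 1 X) (Suc n)) \<longlonglongrightarrow> b"
    using b by (simp add: diag_entry_def [abs_def] coord_shift_by)
  then have "diag_entry (shift_by 1 X) \<longlonglongrightarrow> b" by (rule LIMSEQ_imp_Suc)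
  then show ?thesis
    using X b by (simp add: shift_eq_shift_by boolean_expectation_eq_diag_op shift_by_boolean coord_shift_by)
qed

lemma diag_op_basis: "blinfun_apply (diag_op c d) (basis k) = (if k = None then c else d) *\<^sub>C basis k"
  by (rule ell2_eqI) (simp add: coord_diag_op)

text \<open>Multiplication by diagonal operators on both sides rescales the vacuum entry by
  \<open>c * c'\<close> and each other diagonal entry by \<open>d * d'\<close>; the latter factor
  passes through the limit.\<close>

lemma boolean_expectation_bimodule:
  assumes X: "X \<in> boolean_cstar"
  shows "boolean_expectation (diag_op c d o\<^sub>L X o\<^sub>L diag_op c' d')
    = diag_op c d o\<^sub>L boolean_expectation X o\<^sub>L diag_op c' d'"
proof -
  obtain b where b: "diag_entry X \<longlonglongrightarrow> b" using boolean_cstar_decomposition X by meson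
  note [simp] = coord_diag_op diag_op_basis bounded_ops_scaleC [OF boolean_cstar_bounded [OF X]]
  have "diag_entry (diag_op c d o\<^sub>L X o\<^sub>L diag_op c' d') = (\<lambda>n. d * diag_entry X n * d')"
    by (simp add: diag_entry_def fun_eq_iff)
  moreover have "(\<lambda>n. d * diag_entry X n * d') \<longlonglongrightarrow> d * b * d'"
    by (intro tendsto_intros b)
  ultimately have "diag_entry (diag_op c d o\<^sub>L X o\<^sub>L diag_op c' d') \<longlonglongrightarrow> d * b * d'" by simp
  then show ?thesis
    using X b
    by (simp add: boolean_expectation_eq_diag_op boolean_cstar_closed diag_op_boolean diag_op_compose mult_ac)
qed

lemma matrix_entry_square:
  assumes "Y \<in> bounded_ops"
  shows "coord (blinfun_apply (adj Y o\<^sub>L Y) (basis k)) k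
    = complex_of_real ((norm (blinfun_apply Y (basis k)))\<^sup>2)"
  using cinner_adj [OF assms, of "basis k" "blinfun_apply Y (basis k)"]
    cinner_self [of "blinfun_apply Y (basis k)"]
  by (metis cinner_basis_left complex_cnj_cnj complex_cnj_complex_of_real blinfun_apply_blinfun_compose)

text \<open>The diagonal entries of a positive element are squared norms, so the vacuum entry and
  the diagonal limit are nonnegative reals. Their square roots give a square root inside the range,
  as positivity in the fixed point algebra demands.\<close>

lemma boolean_expectation_positive:
  assumes "positive_in boolean_cstar X"
  shows "\<exists>c d. boolean_expectation X = adj (diag_op c d) o\<^sub>L diag_op c d"
proof -
  obtain Y where Y: "Y \<in> boolean_cstar" and XY: "X = adj Y o\<^sub>L Y"
    using assms by (auto simp: positive_in_def)
  have X: "X \<in> boolean_cstar" unfolding XY by (simp add: Y boolean_cstar_closed)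
  define r where "r k = (norm (blinfun_apply Y (basis k)))\<^sup>2" for k
  have r: "coord (blinfun_apply X (basis k)) k = complex_of_real (r k)" for k
    unfolding XY r_def by (rule matrix_entry_square [OF boolean_cstar_bounded [OF Y]])
  obtain b where b: "diag_entry X \<longlonglongrightarrow> b"
    and E: "boolean_expectation X = diag_op (complex_of_real (r None)) b"
    using boolean_expectation_obtain [OF X] r by metis
  have lim: "(\<lambda>n. complex_of_real (r (Some (int n)))) \<longlonglongrightarrow> b"
    using b by (simp add: diag_entry_def [abs_def] r)
  have "(\<lambda>n. r (Some (int n))) \<longlonglongrightarrow> Re b" using tendsto_Re [OF lim] by simp
  then have "0 \<le> Re b" by (rule LIMSEQ_le_const) (simp add: r_def)
  moreover have "(\<lambda>n. 0 :: real) \<longlonglongrightarrow> Im b" using tendsto_Im [OF lim] by simp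
  then have "Im b = 0" using LIMSEQ_unique tendsto_const by blast
  ultimately have "b = complex_of_real (sqrt (Re b)) * complex_of_real (sqrt (Re b))"
    unfolding of_real_mult [symmetric] by (simp add: complex_eq_iff)
  moreover have "complex_of_real (r None) = complex_of_real (sqrt (r None)) * complex_of_real (sqrt (r None))"
    by (simp add: r_def power2_eq_square)
  ultimately have "boolean_expectation X =
      adj (diag_op (sqrt (r None)) (sqrt (Re b))) o\<^sub>L diag_op (sqrt (r None)) (sqrt (Re b))"
    unfolding E adj_diag_op diag_op_compose complex_cnj_complex_of_real by metis
  then show ?thesis by blast
qed

section \<open>Mixing and uniqueness\<close>

lemma norm_sum_basis_reindex:
  assumes F: "finite F" and g: "inj_on g F"
  shows "norm (\<Sum>k\<in>F. c k *\<^sub>C basis (g k)) = L2_set (\<lambda>k. cmod (c k)) F"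
proof -
  have "(\<Sum>k\<in>F. c k *\<^sub>C basis (g k)) = (\<Sum>i\<in>g ` F. c (inv_into F g i) *\<^sub>C basis i)"
    by (simp add: sum.reindex [OF g] g)
  also have "norm \<dots> = L2_set (\<lambda>i. cmod (c (inv_into F g i))) (g ` F)"
    by (rule norm_sum_basis) (simp add: F)
  also have "\<dots> = L2_set (\<lambda>k. cmod (c k)) F"
    by (simp add: L2_set_def sum.reindex [OF g] g)
  finally show ?thesis .
qed

text \<open>With distinct row indices the terms applied to \<open>x\<close> lie along distinct basis
  vectors. The norm is then an l2 norm of the coefficients weighted by coordinates of
  \<open>x\<close>, each bounded by \<open>norm x\<close>.\<close>

lemma norm_sum_matrix_units_le:
  assumes F: "finite F" and j: "inj_on j F"
  shows "norm (\<Sum>n\<in>F. scaleC_op (c n) (matrix_unit (j n) (k n))) \<le> L2_set (\<lambda>n. cmod (c n)) F"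
proof (rule norm_blinfun_bound)
  fix x
  have "norm (blinfun_apply (\<Sum>n\<in>F. scaleC_op (c n) (matrix_unit (j n) (k n))) x)
      = norm (\<Sum>n\<in>F. (c n * coord x (k n)) *\<^sub>C basis (j n))"
    by (simp add: blinfun.sum_left scaleC_distribs)
  also have "\<dots> = L2_set (\<lambda>n. cmod (c n * coord x (k n))) F"
    by (rule norm_sum_basis_reindex [OF F j])
  also have "\<dots> \<le> L2_set (\<lambda>n. cmod (c n) * norm x) F"
    by (intro L2_set_mono) (auto simp: norm_mult intro!: mult_left_mono cmod_coord_le_norm)
  also have "\<dots> = L2_set (\<lambda>n. cmod (c n)) F * norm x" by (simp add: L2_set_left_distrib)
  finally show "norm (blinfun_apply (\<Sum>n\<in>F. scaleC_op (c n) (matrix_unit (j n) (k n))) x)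
    \<le> L2_set (\<lambda>n. cmod (c n)) F * norm x" .
qed (simp add: L2_set_nonneg)

lemma adj_sum:
  assumes "\<And>n. n \<in> F \<Longrightarrow> T n \<in> bounded_ops"
  shows "adj (\<Sum>n\<in>F. T n) = (\<Sum>n\<in>F. adj (T n))"
  using assms
  by (induction F rule: infinite_finite_induct)
    (simp_all add: adj_zero adj_add subspace_sum [OF subspace_bounded_ops])

text \<open>Distinct columns become distinct rows after passing to the adjoint, which does not
  increase the norm.\<close>

lemma norm_sum_matrix_units_le':
  assumes F: "finite F" and k: "inj_on k F"
  shows "norm (\<Sum>n\<in>F. scaleC_op (c n) (matrix_unit (j n) (k n))) \<le> L2_set (\<lambda>n. cmod (c n)) F"
proof -
  define T where "T = (\<Sum>n\<in>F. scaleC_op (cnj (c n)) (matrix_unit (k n) (j n)))"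
  have bo: "scaleC_op (cnj (c n)) (matrix_unit (k n) (j n)) \<in> bounded_ops" for n
    by (rule bounded_ops_scaleC_op [OF matrix_unit_bounded_ops])
  have "T \<in> bounded_ops"
    unfolding T_def by (rule subspace_sum [OF subspace_bounded_ops bo])
  then have "norm (adj T) \<le> norm T" by (rule norm_adj_le)
  also have "\<dots> \<le> L2_set (\<lambda>n. cmod (c n)) F"
    using norm_sum_matrix_units_le [OF F k, of "\<lambda>n. cnj (c n)" j] by (simp add: T_def)
  also have "adj T = (\<Sum>n\<in>F. scaleC_op (c n) (matrix_unit (j n) (k n)))"
    unfolding T_def
    by (subst adj_sum [OF bo]) (simp add: adj_scaleC_op matrix_unit_bounded_ops adj_matrix_unit)
  finally show ?thesis .
qed

text \<open>A member of \<open>dual_of\<close> is constrained on the algebra only, so the induction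
  has to keep the partial sums inside it.\<close>

lemma dual_of_boolean_sum:
  assumes f: "f \<in> dual_of boolean_cstar" and T: "\<And>n. n \<in> F \<Longrightarrow> T n \<in> boolean_cstar"
  shows "f (\<Sum>n\<in>F. T n) = (\<Sum>n\<in>F. f (T n))"
proof -
  have "f (scaleC_op 0 id_blinfun) = 0 * f id_blinfun"
    using f boolean_cstar_closed(2) unfolding dual_of_def by blast
  then have "f 0 = 0" by simp
  with T show ?thesis
  proof (induction F rule: infinite_finite_induct)
    case (insert n F)
    have "(\<Sum>n\<in>F. T n) \<in> boolean_cstar"
      using insert.prems by (intro subspace_sum [OF subspace_boolean_cstar]) auto
    then have "f (T n + (\<Sum>n\<in>F. T n)) = f (T n) + f (\<Sum>n\<in>F. T n)"
      using f insert.prems(1) [of n] unfolding dual_of_def by blast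
    then show ?case using insert by simp
  qed simp_all
qed

lemma dual_of_boolean_lipschitz:
  assumes f: "f \<in> dual_of boolean_cstar"
  shows "\<exists>K\<ge>0. (\<forall>X\<in>boolean_cstar. cmod (f X) \<le> K * norm X) \<and>
    (\<forall>X\<in>boolean_cstar. \<forall>Y\<in>boolean_cstar. cmod (f X - f Y) \<le> K * norm (X - Y))"
proof -
  obtain K where K: "\<And>X. X \<in> boolean_cstar \<Longrightarrow> cmod (f X) \<le> K * norm X"
    using f unfolding dual_of_def by blast
  have b: "cmod (f X) \<le> \<bar>K\<bar> * norm X" if "X \<in> boolean_cstar" for X
    by (rule order_trans [OF K [OF that]]) (simp add: mult_right_mono)
  have "cmod (f X - f Y) \<le> \<bar>K\<bar> * norm (X - Y)"
    if XY: "X \<in> boolean_cstar" "Y \<in> boolean_cstar" for X Y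
  proof -
    have D: "X - Y \<in> boolean_cstar" by (rule subspace_diff [OF subspace_boolean_cstar XY])
    then have "f ((X - Y) + Y) = f (X - Y) + f Y"
      using f XY(2) unfolding dual_of_def by blast
    then have "f X - f Y = f (X - Y)" by simp
    with b [OF D] show ?thesis by simp
  qed
  with b show ?thesis by (intro exI [of _ "\<bar>K\<bar>"]) simp
qed

text \<open>Testing \<open>f\<close> on \<open>\<Sum> cnj (f E\<^sub>n) E\<^sub>n\<close> shows that the values of \<open>f\<close> along the orbit of a
  matrix unit are square-summable, since the orbit moves one of the two indices injectively.\<close>

lemma dual_of_shifted_matrix_unit_tendsto_0:
  assumes f: "f \<in> dual_of boolean_cstar" and jk: "j \<noteq> None \<or> k \<noteq> None"
  shows "(\<lambda>n. f (shift_by (int n) (matrix_unit j k))) \<longlonglongrightarrow> 0"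
proof -
  obtain K where K: "0 \<le> K" "\<forall>X\<in>boolean_cstar. cmod (f X) \<le> K * norm X"
    "\<forall>X\<in>boolean_cstar. \<forall>Y\<in>boolean_cstar. cmod (f X - f Y) \<le> K * norm (X - Y)"
    using dual_of_boolean_lipschitz [OF f] by blast
  define E where "E n = matrix_unit (map_option (\<lambda>i. i + int n) j) (map_option (\<lambda>i. i + int n) k)" for n
  have E: "E n \<in> boolean_cstar" for n by (simp add: E_def matrix_unit_boolean)
  define a where "a n = f (E n)" for n
  have inj: "inj (\<lambda>n. map_option (\<lambda>i. i + int n) l)" if "l \<noteq> None" for l
    using that by (auto intro!: injI)
  have bound: "(\<Sum>n<N. (cmod (a n))\<^sup>2) \<le> K\<^sup>2" for N
  proof -
    define T where "T = (\<Sum>n<N. scaleC_op (cnj (a n)) (E n))"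
    define l where "l = L2_set (\<lambda>n. cmod (a n)) {..<N}"
    have l: "0 \<le> l" "l\<^sup>2 = (\<Sum>n<N. (cmod (a n))\<^sup>2)"
      by (simp_all add: l_def L2_set_def sum_nonneg)
    have T: "T \<in> boolean_cstar"
      unfolding T_def by (intro subspace_sum [OF subspace_boolean_cstar] boolean_cstar_closed(5) E)
    have "f T = (\<Sum>n<N. f (scaleC_op (cnj (a n)) (E n)))"
      unfolding T_def by (intro dual_of_boolean_sum [OF f] boolean_cstar_closed(5) E)
    also have "\<dots> = (\<Sum>n<N. cnj (a n) * a n)"
      using f E by (intro sum.cong refl) (auto simp: dual_of_def a_def)
    also have "\<dots> = complex_of_real (l\<^sup>2)"
      by (simp add: l(2) complex_norm_square mult.commute del: of_real_power)
    finally have "l\<^sup>2 = cmod (f T)" by (simp add: norm_power l(1))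
    also have "\<dots> \<le> K * norm T" using K(2) T by blast
    also have "norm T \<le> l"
    \<comment> \<open>If the row stays at the vacuum, the columns move and the estimate for distinct
      columns applies; otherwise the rows themselves are distinct.\<close>
    proof (cases "j = None")
      case True
      then have "inj_on (\<lambda>n. map_option (\<lambda>i. i + int n) k) {..<N}"
        using jk by (auto intro!: inj_on_subset [OF inj])
      from norm_sum_matrix_units_le' [OF _ this, of "\<lambda>n. cnj (a n)"]
      show ?thesis by (simp add: T_def E_def l_def)
    next
      case False
      then have "inj_on (\<lambda>n. map_option (\<lambda>i. i + int n) j) {..<N}"
        by (auto intro!: inj_on_subset [OF inj])
      from norm_sum_matrix_units_le [OF _ this, of "\<lambda>n. cnj (a n)"]
      show ?thesis by (simp add: T_def E_def l_def)
    qed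
    finally have "l * l \<le> K * l" using K(1) by (simp add: power2_eq_square mult_left_mono)
    then have "l \<le> K" using l(1) K(1) by (cases "l = 0") (simp_all add: mult_le_cancel_right)
    then have "l\<^sup>2 \<le> K\<^sup>2" using l(1) by (rule power_mono)
    then show ?thesis by (simp add: l(2))
  qed
  have "summable (\<lambda>n. (cmod (a n))\<^sup>2)"
    by (rule bounded_imp_summable [where B = "K\<^sup>2"])
      (use bound [of "Suc _"] in \<open>simp_all add: lessThan_Suc_atMost\<close>)
  then have "(\<lambda>n. (cmod (a n))\<^sup>2) \<longlonglongrightarrow> 0" by (rule summable_LIMSEQ_zero)
  then have "(\<lambda>n. sqrt ((cmod (a n))\<^sup>2)) \<longlonglongrightarrow> sqrt 0" by (rule tendsto_real_sqrt)
  then have "a \<longlonglongrightarrow> 0" by (simp add: tendsto_norm_zero_iff)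
  then show ?thesis by (simp add: a_def [abs_def] E_def shift_by_matrix_unit)
qed

section \<open>The expectation on generators and the mixing limit\<close>

lemma boolean_expectation_id: "boolean_expectation id_blinfun = id_blinfun"
proof -
  have "id_blinfun = diag_op 1 1" by (rule diag_op_eqI) simp
  moreover have "diag_entry id_blinfun \<longlonglongrightarrow> 1" by (simp add: diag_entry_def [abs_def])
  ultimately show ?thesis
    using boolean_expectation_eq_diag_op [OF boolean_cstar_closed(2)] by simp
qed

lemma boolean_expectation_matrix_unit:
  "boolean_expectation (matrix_unit j k) = (if j = None \<and> k = None then matrix_unit None None else 0)"
proof -
  have "diag_entry (matrix_unit j k) \<longlonglongrightarrow> 0"
    by (rule diag_entry_matrix_unit_tendsto)
  then have "boolean_expectation (matrix_unit j k) = diag_op (if j = None \<and> k = None then 1 else 0) 0"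
    using boolean_expectation_eq_diag_op [OF matrix_unit_boolean] by auto
  also have "\<dots> = (if j = None \<and> k = None then matrix_unit None None else 0)"
    by (simp add: diag_op_def vacuum_proj_def scaleC_op_one)
  finally show ?thesis .
qed

lemma boolean_expectation_diff:
  assumes X: "X \<in> boolean_cstar" and Y: "Y \<in> boolean_cstar"
  shows "boolean_expectation (X - Y) = boolean_expectation X - boolean_expectation Y"
  using boolean_expectation_add [OF subspace_diff [OF subspace_boolean_cstar X Y] Y] by simp

lemma shift_by_diff: "shift_by d (X - Y) = shift_by d X - shift_by d Y"
  using shift_by_add [of d "X - Y" Y] by simp

lemma boolean_cstar_mixing:
  assumes f: "f \<in> dual_of boolean_cstar" and X: "X \<in> boolean_cstar"
  shows "(\<lambda>n. f (shift_by (int n) X)) \<longlonglongrightarrow> f (boolean_expectation X)"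
proof -
  obtain K where K: "0 \<le> K" "\<forall>X\<in>boolean_cstar. cmod (f X) \<le> K * norm X"
    "\<forall>X\<in>boolean_cstar. \<forall>Y\<in>boolean_cstar. cmod (f X - f Y) \<le> K * norm (X - Y)"
    using dual_of_boolean_lipschitz [OF f] by blast
  have add: "f (X + Y) = f X + f Y" if "X \<in> boolean_cstar" "Y \<in> boolean_cstar" for X Y
    using f that by (simp add: dual_of_def)
  have scale: "f (scaleC_op c X) = c * f X" if "X \<in> boolean_cstar" for c X
    using f that by (simp add: dual_of_def)
  define S where "S = {X \<in> boolean_cstar. (\<lambda>n. f (shift_by (int n) X)) \<longlonglongrightarrow> f (boolean_expectation X)}"
  have S_scale: "scaleC_op c X \<in> S" if "X \<in> S" for c X
    using that unfolding S_def
    by (auto simp: shift_by_scaleC_op boolean_expectation_scaleC_op scale shift_by_boolean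
        boolean_expectation_boolean boolean_cstar_closed intro!: tendsto_mult_left)
  have id: "id_blinfun \<in> S"
    by (simp add: S_def shift_by_id boolean_expectation_id boolean_cstar_closed)
  have "boolean_cstar \<subseteq> S"
  proof (rule boolean_cstar_subset_closed_subspace)
    show "subspace S"
      unfolding subspace_def scaleR_eq_scaleC_op
    proof (intro conjI ballI allI S_scale)
      show "0 \<in> S" using S_scale [OF id, of 0] by simp
      show "X + Y \<in> S" if "X \<in> S" "Y \<in> S" for X Y
        using that unfolding S_def
        by (auto simp: shift_by_add boolean_expectation_add add shift_by_boolean
            boolean_expectation_boolean boolean_cstar_closed intro!: tendsto_add)
    qed
    show "closed S"
      unfolding closed_sequential_limits
    proof (intro allI impI, elim conjE)
      fix T :: "nat \<Rightarrow> int option op" and Y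
      assume TS: "\<forall>m. T m \<in> S" and lim: "T \<longlonglongrightarrow> Y"
      then have T: "T m \<in> boolean_cstar"
        "(\<lambda>n. f (shift_by (int n) (T m))) \<longlonglongrightarrow> f (boolean_expectation (T m))" for m
        by (auto simp: S_def)
      have Y: "Y \<in> boolean_cstar"
        by (rule closed_sequentially [OF boolean_cstar_closed(7) T(1) lim])
      have nlim: "(\<lambda>m. K * norm (T m - Y)) \<longlonglongrightarrow> 0"
        using tendsto_mult_left [OF tendsto_norm_zero [OF LIM_zero [OF lim]], of K] by simp
      \<comment> \<open>Shifts are contractive, so approximating \<open>Y\<close> by
        \<open>T m\<close> changes the values of \<open>f\<close> along the whole orbit by at most
        \<open>K * norm (T m - Y)\<close>, independently of \<open>n\<close>. The limits in
        \<open>m\<close> and \<open>n\<close> may then be exchanged.\<close>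
      have unif: "uniform_limit UNIV (\<lambda>m n. f (shift_by (int n) (T m))) (\<lambda>n. f (shift_by (int n) Y)) sequentially"
      proof (rule uniform_limitI)
        fix e :: real assume "0 < e"
        then have "\<forall>\<^sub>F m in sequentially. K * norm (T m - Y) < e"
          by (rule order_tendstoD(2) [OF nlim])
        then show "\<forall>\<^sub>F m in sequentially. \<forall>n\<in>UNIV. dist (f (shift_by (int n) (T m))) (f (shift_by (int n) Y)) < e"
        proof (rule eventually_mono, intro ballI)
          fix m n assume m: "K * norm (T m - Y) < e"
          have "dist (f (shift_by (int n) (T m))) (f (shift_by (int n) Y))
              \<le> K * norm (shift_by (int n) (T m) - shift_by (int n) Y)"
            unfolding dist_norm by (intro K(3) [rule_format] shift_by_boolean T Y)
          also have "\<dots> \<le> K * norm (T m - Y)"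
            unfolding shift_by_diff [symmetric] by (intro mult_left_mono norm_shift_by_le K(1))
          finally show "dist (f (shift_by (int n) (T m))) (f (shift_by (int n) Y)) < e"
            using m by simp
        qed
      qed
      have "(\<lambda>m. f (boolean_expectation (T m)) - f (boolean_expectation Y)) \<longlonglongrightarrow> 0"
      proof (rule Lim_null_comparison [OF always_eventually nlim], intro allI)
        fix m
        have "cmod (f (boolean_expectation (T m)) - f (boolean_expectation Y))
            \<le> K * norm (boolean_expectation (T m) - boolean_expectation Y)"
          by (intro K(3) [rule_format] boolean_expectation_boolean T Y)
        also have "\<dots> \<le> K * norm (T m - Y)"
          unfolding boolean_expectation_diff [OF T(1) Y, symmetric]
          by (intro mult_left_mono norm_boolean_expectation_le K(1)
              subspace_diff [OF subspace_boolean_cstar] T Y)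
        finally show "norm (f (boolean_expectation (T m)) - f (boolean_expectation Y)) \<le> K * norm (T m - Y)" .
      qed
      then have "(\<lambda>m. f (boolean_expectation (T m))) \<longlonglongrightarrow> f (boolean_expectation Y)"
        by (rule LIM_zero_cancel)
      from swap_uniform_limit' [OF _ this unif]
      have "(\<lambda>n. f (shift_by (int n) Y)) \<longlonglongrightarrow> f (boolean_expectation Y)"
        by (simp add: T(2))
      with Y show "Y \<in> S" by (simp add: S_def)
    qed
    show "scaleC_op c id_blinfun \<in> S" for c by (rule S_scale [OF id])
    have "matrix_unit j k \<in> S" for j k
    proof (cases "j = None \<and> k = None")
      case True
      \<comment> \<open>The vacuum projection is fixed by the shift and by the expectation, so the
        sequence is constant.\<close>
      then show ?thesis
        by (simp add: S_def boolean_expectation_matrix_unit shift_by_matrix_unit matrix_unit_boolean)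
    next
      case False
      have "f 0 = 0" using scale [OF boolean_cstar_closed(2), of 0] by simp
      moreover have "(\<lambda>n. f (shift_by (int n) (matrix_unit j k))) \<longlonglongrightarrow> 0"
        by (rule dual_of_shifted_matrix_unit_tendsto_0 [OF f]) (use False in simp)
      moreover have "boolean_expectation (matrix_unit j k) = 0"
        using False by (auto simp: boolean_expectation_matrix_unit)
      ultimately show ?thesis by (simp add: S_def matrix_unit_boolean)
    qed
    then show "scaleC_op c (matrix_unit j k) \<in> S" for c j k by (rule S_scale)
  qed
  with X show ?thesis by (auto simp: S_def)
qed

section \<open>Fixed points and uniqueness\<close>

lemma dual_of_boolean_separates:
  assumes "X \<in> boolean_cstar" "Y \<in> boolean_cstar"
    and eq: "\<And>f. f \<in> dual_of boolean_cstar \<Longrightarrow> f X = f Y"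
  shows "X = Y"
proof (rule bounded_ops_eqI)
  fix j k
  \<comment> \<open>The separating functionals are the matrix entries, bounded with constant
    1.\<close>
  have "(\<lambda>X. coord (blinfun_apply X (basis k)) j) \<in> dual_of boolean_cstar"
    unfolding dual_of_def
    by (auto simp: blinfun.add_left cmod_matrix_entry_le intro!: exI [of _ 1])
  then show "coord (blinfun_apply X (basis k)) j = coord (blinfun_apply Y (basis k)) j"
    by (rule eq)
qed (simp_all add: assms boolean_cstar_bounded)

text \<open>The orbit of a fixed point is constant, so mixing identifies the values of every
  functional at \<open>X\<close> and at its expectation.\<close>

lemma boolean_expectation_fixed_point:
  assumes "X \<in> fixed_points boolean_cstar shift"
  shows "boolean_expectation X = X"
proof -
  have X: "X \<in> boolean_cstar" and fp: "shift X = X"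
    using assms by (auto simp: fixed_points_def)
  have "shift_by (int n) X = X" for n
    unfolding shift_funpow [symmetric] by (induction n) (simp_all add: fp)
  then have "f X = f (boolean_expectation X)" if "f \<in> dual_of boolean_cstar" for f
    using boolean_cstar_mixing [OF that X] by (simp add: LIMSEQ_const_iff)
  then show ?thesis
    using dual_of_boolean_separates [OF X boolean_expectation_boolean [OF X]] by simp
qed

lemma fixed_points_boolean_cstar: "fixed_points boolean_cstar shift = {diag_op c d |c d. True}"
proof (intro equalityI subsetI)
  fix X assume X: "X \<in> fixed_points boolean_cstar shift"
  then have "X \<in> boolean_cstar" by (simp add: fixed_points_def)
  then obtain b where "boolean_expectation X = diag_op (coord (blinfun_apply X (basis None)) None) b"
    by (rule boolean_expectation_obtain)
  then show "X \<in> {diag_op c d |c d. True}"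
    unfolding boolean_expectation_fixed_point [OF X] by blast
next
  fix X assume "X \<in> {diag_op c d |c d. True}"
  then show "X \<in> fixed_points boolean_cstar shift"
    by (auto simp: fixed_points_def diag_op_boolean shift_eq_shift_by shift_by_diag_op)
qed

lemma invariant_conditional_expectation_boolean_expectation:
  "invariant_conditional_expectation boolean_cstar shift boolean_expectation"
  unfolding invariant_conditional_expectation_def conditional_expectation_def
    complex_linear_on_def
proof (intro conjI ballI allI impI)
  show "fixed_points boolean_cstar shift \<subseteq> boolean_cstar" by (auto simp: fixed_points_def)
  show "boolean_expectation ` boolean_cstar \<subseteq> fixed_points boolean_cstar shift"
    by (auto simp: fixed_points_def boolean_expectation_boolean shift_eq_shift_by
        boolean_expectation_shift_by_fixed)
  show "positive_in (fixed_points boolean_cstar shift) (boolean_expectation X)"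
    if "positive_in boolean_cstar X" for X
    using boolean_expectation_positive [OF that] by (auto simp: positive_in_def fixed_points_boolean_cstar)
  show "boolean_expectation (Y o\<^sub>L X o\<^sub>L Z) = Y o\<^sub>L boolean_expectation X o\<^sub>L Z"
    if "X \<in> boolean_cstar" "Y \<in> fixed_points boolean_cstar shift"
      "Z \<in> fixed_points boolean_cstar shift" for X Y Z
    using that by (auto simp: fixed_points_boolean_cstar boolean_expectation_bimodule)
qed (simp_all add: boolean_expectation_add boolean_expectation_scaleC_op
    boolean_expectation_fixed_point norm_boolean_expectation_le boolean_expectation_shift)

text \<open>By invariance \<open>f (F X)\<close> is constant along the orbit of \<open>X\<close>.
  Mixing for the functional \<open>f\<close> composed with \<open>F\<close> makes this constant
  equal to \<open>f (F (boolean_expectation X))\<close>, and \<open>F\<close> fixes the expectation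
  of \<open>X\<close> because it is a fixed point.\<close>

lemma invariant_conditional_expectation_unique:
  assumes F: "invariant_conditional_expectation boolean_cstar shift F" and X: "X \<in> boolean_cstar"
  shows "F X = boolean_expectation X"
proof -
  have fp: "F Y \<in> fixed_points boolean_cstar shift" if "Y \<in> boolean_cstar" for Y
    using F that unfolding invariant_conditional_expectation_def conditional_expectation_def by blast
  then have FB: "F Y \<in> boolean_cstar" if "Y \<in> boolean_cstar" for Y
    using that by (simp add: fixed_points_def)
  have FE: "F (boolean_expectation X) = boolean_expectation X"
    using F X unfolding invariant_conditional_expectation_def conditional_expectation_def
    by (simp add: fixed_points_def boolean_expectation_boolean shift_eq_shift_by
        boolean_expectation_shift_by_fixed)
  have inv: "F (shift_by (int n) X) = F X" for n
  proof (induction n)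
    case (Suc n)
    have "F (shift (shift_by (int n) X)) = F (shift_by (int n) X)"
      using F shift_by_boolean [OF X] unfolding invariant_conditional_expectation_def by blast
    then show ?case by (simp add: Suc shift_eq_shift_by shift_by_shift_by)
  qed (simp add: shift_by_0)
  have "f (F X) = f (boolean_expectation X)" if f: "f \<in> dual_of boolean_cstar" for f
  proof -
    obtain K where K: "0 \<le> K" "\<forall>X\<in>boolean_cstar. cmod (f X) \<le> K * norm X"
    "\<forall>X\<in>boolean_cstar. \<forall>Y\<in>boolean_cstar. cmod (f X - f Y) \<le> K * norm (X - Y)"
      using dual_of_boolean_lipschitz [OF f] by blast
    have "cmod (f (F Y)) \<le> K * norm Y" if Y: "Y \<in> boolean_cstar" for Y
    proof -
      have "norm (F Y) \<le> norm Y"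
        using F Y unfolding invariant_conditional_expectation_def conditional_expectation_def by blast
      then show ?thesis
        using bspec [OF K(2) FB [OF Y]] mult_left_mono [OF _ K(1)] order_trans by blast
    qed
    \<comment> \<open>Contractivity of \<open>F\<close> supplies the bound, and its complex
      linearity into the algebra supplies the rest.\<close>
    then have "(\<lambda>Y. f (F Y)) \<in> dual_of boolean_cstar"
      using F f FB unfolding dual_of_def invariant_conditional_expectation_def
        conditional_expectation_def complex_linear_on_def by auto
    from boolean_cstar_mixing [OF this X] show ?thesis
      by (simp add: inv FE LIMSEQ_const_iff)
  qed
  then show ?thesis
    by (rule dual_of_boolean_separates [OF FB [OF X] boolean_expectation_boolean [OF X]])
qed

theorem proposition7p2:
  shows "cstar_dynamical_system boolean_cstar shift
    \<and> uniquely_mixing_wrt_fixed_points boolean_cstar shift boolean_expectation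
    \<and> (\<forall>F. invariant_conditional_expectation boolean_cstar shift F
          \<longrightarrow> (\<forall>X\<in>boolean_cstar. F X = boolean_expectation X))"
  unfolding cstar_dynamical_system_def uniquely_mixing_wrt_fixed_points_def shift_funpow
  by (intro conjI allI impI ballI boolean_cstar_unital star_automorphism_shift
      invariant_conditional_expectation_boolean_expectation boolean_cstar_mixing
      invariant_conditional_expectation_unique)

end
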